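(* On the Pascal graph, for any ergodic probability measure on the path space under which the vertex process $(V_n)_{n\le0}$ is a Markov process, the filtration $\mathcal{F}$ generated by $(V_n)_{n\le0}$ admits a generating parameterization; hence it is standard.
   Context: The Pascal graph has, at each level $n\le0$, vertices labelled $0,\dots,|n|$; vertex $v$ at level $n$ is joined by one edge to each of the vertices $v$ and $v+1$ at level $n-1$. $V_n$ is the vertex at level $n$ of the random path. A probability measure on the path space is ergodic if the natural filtration of the random path (here equal to $\mathcal F_n=\sigma(V_m;m\le n)$) has trivial tail $\sigma$-field $\bigcap_n\mathcal F_n$. A parameterization of $\mathcal{F}$ is a sequence $(U_n)$ with $U_n$ independent of $\mathcal{F}_{n-1}\vee\sigma(U_m;m\le n-1)$ and $\mathcal{F}_n\subset\mathcal{F}_{n-1}\vee\sigma(U_n)$; it is generating if $\mathcal{F}_n\subset\sigma(U_m;m\le n)$ for all $n$ ("admits" is understood up to isomorphism, i.e. for a copy of the process). Standard: up to isomorphism, immersed in a filtration generated by independent random variables. *)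

theory Defs
  imports "HOL-Probability.Probability"
begin

text \<open>Indexing convention: a level n \<le> 0 of the Pascal graph is encoded by the depth
  k = -n :: nat.  A path is a function omega :: nat => nat with omega k = V_{-k}.
  F_n = sigma(V_m; m \<le> n) becomes the sigma-field generated by the coordinates j \<ge> k.\<close>

definition pascal_paths :: "(nat \<Rightarrow> nat) set" where
  "pascal_paths = {\<omega>. \<omega> 0 = 0 \<and> (\<forall>k. \<omega> (Suc k) = \<omega> k \<or> \<omega> (Suc k) = Suc (\<omega> k))}"

definition pascal_space :: "(nat \<Rightarrow> nat) measure" where
  "pascal_space = restrict_space (Pi\<^sub>M UNIV (\<lambda>_. count_space UNIV)) pascal_paths"

definition sa_of :: "'a set \<Rightarrow> ('a \<Rightarrow> 'b) \<Rightarrow> 'b measure \<Rightarrow> 'a set set" where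
  "sa_of \<Omega> f N = {f -` A \<inter> \<Omega> | A. A \<in> sets N}"

definition sa_fam :: "'a set \<Rightarrow> ('i \<Rightarrow> 'a \<Rightarrow> 'b) \<Rightarrow> 'b measure \<Rightarrow> 'i set \<Rightarrow> 'a set set" where
  "sa_fam \<Omega> X N J = sigma_sets \<Omega> (\<Union>j\<in>J. sa_of \<Omega> (X j) N)"

definition nat_filt :: "'a measure \<Rightarrow> (nat \<Rightarrow> 'a \<Rightarrow> nat) \<Rightarrow> nat \<Rightarrow> 'a set set" where
  "nat_filt M V k = sa_fam (space M) V (count_space UNIV) {k..}"

definition aug_null :: "'a measure \<Rightarrow> 'a set set \<Rightarrow> 'a set set" where
  "aug_null M A = {b. \<exists>a\<in>A. \<exists>N\<in>null_sets M. (b - a) \<union> (a - b) \<subseteq> N}"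

definition coord :: "nat \<Rightarrow> (nat \<Rightarrow> nat) \<Rightarrow> nat" where
  "coord k \<omega> = \<omega> k"

definition pascal_ergodic :: "(nat \<Rightarrow> nat) measure \<Rightarrow> bool" where
  "pascal_ergodic P \<longleftrightarrow>
     (\<forall>A \<in> (\<Inter>k. nat_filt P coord k). measure P A = 0 \<or> measure P A = 1)"

text \<open>Markov property (discrete state space): for every n, V_n and F_{n-1} are
  conditionally independent given V_{n-1}.  With k = -n: V_k and nat_filt (Suc k) given V_{Suc k}.\<close>
definition pascal_markov :: "(nat \<Rightarrow> nat) measure \<Rightarrow> bool" where
  "pascal_markov P \<longleftrightarrow>
     (\<forall>k v w. \<forall>A \<in> nat_filt P coord (Suc k).
        measure P ({\<omega> \<in> space P. \<omega> k = v \<and> \<omega> (Suc k) = w} \<inter> A)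
          * measure P {\<omega> \<in> space P. \<omega> (Suc k) = w}
        = measure P {\<omega> \<in> space P. \<omega> k = v \<and> \<omega> (Suc k) = w}
          * measure P ({\<omega> \<in> space P. \<omega> (Suc k) = w} \<inter> A))"

definition is_copy :: "'b measure \<Rightarrow> (nat \<Rightarrow> 'b \<Rightarrow> nat) \<Rightarrow> (nat \<Rightarrow> nat) measure \<Rightarrow> bool" where
  "is_copy Q V' P \<longleftrightarrow> prob_space Q \<and> (\<forall>k. V' k \<in> Q \<rightarrow>\<^sub>M count_space UNIV) \<and>
     distr Q (Pi\<^sub>M UNIV (\<lambda>_. count_space UNIV)) (\<lambda>\<omega> k. V' k \<omega>)
       = distr P (Pi\<^sub>M UNIV (\<lambda>_. count_space UNIV)) (\<lambda>\<omega>. \<omega>)"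

text \<open>Generating parameterization (U_{-k} = U k), up to isomorphism and modulo null sets:
  U_n independent of F_{n-1} v sigma(U_m; m \<le> n-1);  F_n \<subseteq> F_{n-1} v sigma(U_n);
  F_n \<subseteq> sigma(U_m; m \<le> n).\<close>
definition admits_generating_param :: "(nat \<Rightarrow> nat) measure \<Rightarrow> bool" where
  "admits_generating_param P \<longleftrightarrow>
     (\<exists>(Q :: (nat \<Rightarrow> real) measure) V' (U :: nat \<Rightarrow> (nat \<Rightarrow> real) \<Rightarrow> real).
        is_copy Q V' P \<and> (\<forall>k. U k \<in> borel_measurable Q) \<and>
        (\<forall>k. prob_space.indep_set Q (sa_of (space Q) (U k) borel)
               (sigma_sets (space Q) (nat_filt Q V' (Suc k) \<union> sa_fam (space Q) U borel {Suc k..}))) \<and>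
        (\<forall>k. nat_filt Q V' k \<subseteq>
               aug_null Q (sigma_sets (space Q) (nat_filt Q V' (Suc k) \<union> sa_of (space Q) (U k) borel))) \<and>
        (\<forall>k. nat_filt Q V' k \<subseteq> aug_null Q (sa_fam (space Q) U borel {k..})))"

definition martingale_wrt :: "'a measure \<Rightarrow> (nat \<Rightarrow> 'a set set) \<Rightarrow> (nat \<Rightarrow> 'a \<Rightarrow> real) \<Rightarrow> bool" where
  "martingale_wrt M F X \<longleftrightarrow>
     (\<forall>k. integrable M (X k) \<and> X k \<in> borel_measurable (sigma (space M) (F k)) \<and>
          (AE \<omega> in M. real_cond_exp M (sigma (space M) (F (Suc k))) (X k) \<omega> = X (Suc k) \<omega>))"

definition immersed :: "'a measure \<Rightarrow> (nat \<Rightarrow> 'a set set) \<Rightarrow> (nat \<Rightarrow> 'a set set) \<Rightarrow> bool" where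
  "immersed M F G \<longleftrightarrow> (\<forall>k. F k \<subseteq> G k) \<and> (\<forall>X. martingale_wrt M F X \<longrightarrow> martingale_wrt M G X)"

definition standard_filt :: "(nat \<Rightarrow> nat) measure \<Rightarrow> bool" where
  "standard_filt P \<longleftrightarrow>
     (\<exists>(Q :: (nat \<Rightarrow> real) measure) V' (W :: nat \<Rightarrow> (nat \<Rightarrow> real) \<Rightarrow> real).
        is_copy Q V' P \<and> (\<forall>k. W k \<in> borel_measurable Q) \<and>
        prob_space.indep_vars Q (\<lambda>_. borel) W UNIV \<and>
        immersed (completion Q) (\<lambda>k. aug_null Q (nat_filt Q V' k))
                                (\<lambda>k. aug_null Q (sa_fam (space Q) W borel {k..})))"

end

theory Submission
  imports Defs
begin

text \<open>
  Write \<open>V k = pascal_step (q k) (V (Suc k)) (U k)\<close> with uniform innovations \<open>U k\<close> obtained by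
  adjoining independent uniform variables to the path.  A step lowers the vertex by at most one, so for
  every value of the innovation it is nondecreasing in the vertex, and so are the composed flows.
  Given the past at depth \<open>k + d\<close>, the event \<open>v \<le> V k\<close> has a conditional probability that is a
  function of \<open>V (k + d)\<close>; it is a reverse martingale and converges to a constant because the tail is
  trivial.  By monotonicity, the probability that the flows started at \<open>V (k + d)\<close> and at a well chosen
  deterministic vertex disagree about \<open>v \<le> V k\<close> is an \<open>L\<^sup>1\<close> distance between such conditional
  probabilities, hence small.  So \<open>V k\<close> is a limit of functions of the innovations.
  Immersion holds since \<open>U k\<close> is independent of everything deeper.
\<close>

section \<open>Generated and augmented \<open>\<sigma>\<close>-algebras\<close>

text \<open>A trivial tail and independent innovations do not by themselves make the innovations
  generate; it has to be shown that the flow forgets its starting vertex. Closeness of conditional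
  probabilities says in general nothing about closeness of events, and here the order closes the
  gap. For a fixed start \<open>w\<close>, the flow event is contained in \<open>v \<le> V k\<close>
  on \<open>w \<le> V (k + d)\<close> and contains it on the complement. On each side the
  probability of disagreement is therefore a plain difference, and no cancellation can hide it. The
  deterministic vertex comes from an averaging argument: a function with small mean is small at some
  point, and the vertex of that point serves as \<open>w\<close>. Independence is kept throughout
  relative to the joint past \<open>H\<close> of vertices and innovations: generation needs it for
  the flow, immersion needs it for past innovations conditioned on past vertices. The recursion for
  \<open>V k\<close> is arranged to hold at every point, so null sets enter only in the limits and
  in the augmented filtrations.\<close>

lemma sa_of_subset_sets: "X \<in> M \<rightarrow>\<^sub>M N \<Longrightarrow> sa_of (space M) X N \<subseteq> sets M"
  by (auto simp: sa_of_def)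

lemma sa_of_subset_Pow: "sa_of \<Omega> X N \<subseteq> Pow \<Omega>"
  by (auto simp: sa_of_def)

lemma sa_fam_sigma_algebra: "sigma_algebra \<Omega> (sa_fam \<Omega> X N J)"
  unfolding sa_fam_def by (rule sigma_algebra_sigma_sets) (auto simp: sa_of_def)

lemma sa_fam_subset_Pow: "sa_fam \<Omega> X N J \<subseteq> Pow \<Omega>"
  using sa_fam_sigma_algebra sigma_algebra_iff2 by metis

lemma sa_fam_mono: "J \<subseteq> K \<Longrightarrow> sa_fam \<Omega> X N J \<subseteq> sa_fam \<Omega> X N K"
  unfolding sa_fam_def by (intro sigma_sets_mono') auto

lemma sa_of_subset_sa_fam: "j \<in> J \<Longrightarrow> sa_of \<Omega> (X j) N \<subseteq> sa_fam \<Omega> X N J"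
  unfolding sa_fam_def by auto

lemma sa_fam_subset:
  assumes "sigma_algebra \<Omega> S" "\<And>j. j \<in> J \<Longrightarrow> sa_of \<Omega> (X j) N \<subseteq> S"
  shows "sa_fam \<Omega> X N J \<subseteq> S"
  unfolding sa_fam_def using assms by (intro sigma_algebra.sigma_sets_subset) auto

lemma sa_fam_subset_sets:
  "(\<And>j. j \<in> J \<Longrightarrow> X j \<in> M \<rightarrow>\<^sub>M N) \<Longrightarrow> sa_fam (space M) X N J \<subseteq> sets M"
  by (intro sa_fam_subset sets.sigma_algebra_axioms sa_of_subset_sets)

lemma sets_sigma_sa_fam: "sets (sigma \<Omega> (sa_fam \<Omega> X N J)) = sa_fam \<Omega> X N J"
  by (simp add: sa_fam_subset_Pow sets_measure_of sigma_algebra.sigma_sets_eq sa_fam_sigma_algebra)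

lemma measurable_sa_fam:
  "j \<in> J \<Longrightarrow> X j \<in> \<Omega> \<rightarrow> space N \<Longrightarrow> X j \<in> sigma \<Omega> (sa_fam \<Omega> X N J) \<rightarrow>\<^sub>M N"
  using sa_of_subset_sa_fam[of j J \<Omega> X N]
  by (intro measurableI) (auto simp: sets_sigma_sa_fam sa_of_def sa_fam_subset_Pow space_measure_of_conv)

lemma measurable_sigma_imp_sa_of_subset:
  assumes "sigma_algebra \<Omega> S" "X \<in> sigma \<Omega> S \<rightarrow>\<^sub>M N"
  shows "sa_of \<Omega> X N \<subseteq> S"
proof -
  have "sets (sigma \<Omega> S) = S"
    by (rule sigma_algebra.sets_measure_of_eq[OF assms(1)])
  then show ?thesis
    using measurable_sets[OF assms(2)] by (auto simp: sa_of_def space_measure_of_conv)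
qed

text \<open>Serves twice for the copy: to identify its vertex filtration with preimages of the
  original one, and to see that events generated by fractional parts depend on these parts
  only.\<close>

lemma sa_fam_comp:
  assumes f: "f \<in> \<Omega>' \<rightarrow> \<Omega>"
  shows "sa_fam \<Omega>' (\<lambda>j x. X j (f x)) N J = (\<lambda>B. f -` B \<inter> \<Omega>') ` sa_fam \<Omega> X N J"
proof -
  have eq: "(\<lambda>x. X j (f x)) -` A \<inter> \<Omega>' = f -` (X j -` A \<inter> \<Omega>) \<inter> \<Omega>'" for j A
    using f by auto
  have "(\<Union>j\<in>J. sa_of \<Omega>' (\<lambda>x. X j (f x)) N) = (\<lambda>B. f -` B \<inter> \<Omega>') ` (\<Union>j\<in>J. sa_of \<Omega> (X j) N)"
    unfolding sa_of_def eq by blast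
  moreover have "sigma_sets \<Omega>' ((\<lambda>B. f -` B \<inter> \<Omega>') ` S) = (\<lambda>B. f -` B \<inter> \<Omega>') ` sigma_sets \<Omega> S" for S
    using sigma_sets_vimage_commute[OF f, of S] by (simp add: image_def Bex_def setcompr_eq_image)
  ultimately show ?thesis
    unfolding sa_fam_def by simp
qed

section \<open>Augmentation by null sets\<close>

lemma subset_aug_null: "S \<subseteq> aug_null M S"
proof
  fix a assume "a \<in> S"
  then show "a \<in> aug_null M S"
    unfolding aug_null_def by (intro CollectI bexI[of _ a] bexI[of _ "{}"]) auto
qed

lemma aug_null_mono: "S \<subseteq> T \<Longrightarrow> aug_null M S \<subseteq> aug_null M T"
  unfolding aug_null_def by blast

lemma aug_null_idem: "aug_null M (aug_null M S) \<subseteq> aug_null M S"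
proof
  fix b assume "b \<in> aug_null M (aug_null M S)"
  then obtain a N a' N' where *: "N \<in> null_sets M" "(b - a) \<union> (a - b) \<subseteq> N"
     "a' \<in> S" "N' \<in> null_sets M" "(a - a') \<union> (a' - a) \<subseteq> N'"
    unfolding aug_null_def by blast
  then have "N \<union> N' \<in> null_sets M" "(b - a') \<union> (a' - b) \<subseteq> N \<union> N'" by auto
  with * show "b \<in> aug_null M S" unfolding aug_null_def by blast
qed

lemma aug_null_subset_Pow:
  assumes "S \<subseteq> Pow (space M)" shows "aug_null M S \<subseteq> Pow (space M)"
proof
  fix b assume "b \<in> aug_null M S"
  then obtain a N where *: "a \<in> S" "N \<in> null_sets M" "(b - a) \<union> (a - b) \<subseteq> N"
    unfolding aug_null_def by blast
  then have "N \<subseteq> space M" by (meson null_setsD2 sets.sets_into_space)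
  with * assms show "b \<in> Pow (space M)" by blast
qed

lemma aug_null_sigma_algebra:
  assumes S: "sigma_algebra (space M) S"
  shows "sigma_algebra (space M) (aug_null M S)"
proof -
  interpret S: sigma_algebra "space M" S by fact
  show ?thesis unfolding sigma_algebra_iff2
  proof (intro conjI ballI allI impI)
    show "aug_null M S \<subseteq> Pow (space M)"
      by (rule aug_null_subset_Pow) (rule S.space_closed)
    show "{} \<in> aug_null M S" using subset_aug_null by blast
    fix s assume "s \<in> aug_null M S"
    then obtain a N where *: "a \<in> S" "N \<in> null_sets M" "(s - a) \<union> (a - s) \<subseteq> N"
      unfolding aug_null_def by blast
    then show "space M - s \<in> aug_null M S"
      unfolding aug_null_def by (intro CollectI bexI[of _ "space M - a"] bexI[of _ N]) auto
  next
    fix A :: "nat \<Rightarrow> _" assume "range A \<subseteq> aug_null M S"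
    then have "\<forall>i. \<exists>a N. a \<in> S \<and> N \<in> null_sets M \<and> (A i - a) \<union> (a - A i) \<subseteq> N"
      unfolding aug_null_def by blast
    then obtain a N where *: "\<And>i. a i \<in> S" "\<And>i. N i \<in> null_sets M"
        "\<And>i. (A i - a i) \<union> (a i - A i) \<subseteq> N i"
      by metis
    show "(\<Union>i. A i) \<in> aug_null M S"
      unfolding aug_null_def
    proof (intro CollectI bexI)
      show "(\<Union>i. A i) - (\<Union>i. a i) \<union> ((\<Union>i. a i) - (\<Union>i. A i)) \<subseteq> (\<Union>i. N i)"
        using *(3) by blast
    qed (use * in auto)
  qed
qed

text \<open>A member of \<open>aug_null M S\<close> may differ from its representative by a
  non-measurable part of a null set. It is measurable only for the completion, where the later
  conditional expectations are taken.\<close>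

lemma aug_null_completionE:
  assumes "b \<in> aug_null M S" "S \<subseteq> sets M"
  obtains a where "a \<in> S" "AE x in completion M. x \<in> b \<longleftrightarrow> x \<in> a" "b \<in> sets (completion M)"
proof -
  obtain a N where *: "a \<in> S" "N \<in> null_sets M" "(b - a) \<union> (a - b) \<subseteq> N"
    using assms unfolding aug_null_def by blast
  have N: "N \<in> null_sets (completion M)" using *(2) by (simp add: null_sets_completionI)
  have ae: "AE x in completion M. x \<in> b \<longleftrightarrow> x \<in> a"
    by (rule AE_I'[OF N]) (use * in auto)
  have "b - a \<in> null_sets (completion M)" "a - b \<in> null_sets (completion M)"
    by (rule null_sets_completion_subset[OF _ N], use *(3) in blast)+
  moreover have "a \<in> sets (completion M)" using * assms by auto
  moreover have "b = (a - (a - b)) \<union> (b - a)" by auto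
  ultimately have "b \<in> sets (completion M)"
    using sets.Un[OF sets.Diff null_setsD2] null_setsD2 by metis
  with that * ae show ?thesis by blast
qed

lemma (in prob_space) approx_imp_aug_null:
  assumes S: "sigma_algebra (space M) S" "S \<subseteq> events" and E: "E \<in> events"
    and approx: "\<And>e. e > 0 \<Longrightarrow> \<exists>C\<in>S. prob ((E - C) \<union> (C - E)) < e"
  shows "E \<in> aug_null M S"
proof -
  interpret S: sigma_algebra "space M" S by fact
  have "\<forall>n::nat. \<exists>C\<in>S. prob ((E - C) \<union> (C - E)) < (1/2)^n"
    using approx by simp
  then obtain C where C: "\<And>n. C n \<in> S" "\<And>n. prob ((E - C n) \<union> (C n - E)) < (1/2)^n"
    by metis
  define D where "D n = (E - C n) \<union> (C n - E)" for n
  have Cev[measurable]: "C n \<in> events" for n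
    using C(1) S(2) by blast
  have [measurable]: "D n \<in> events" for n
    using E by (simp add: D_def)
  have "summable (\<lambda>n. prob (D n))"
    by (rule summable_comparison_test[of _ "\<lambda>n. (1/2)^n"]) (use C in \<open>auto simp: D_def less_imp_le\<close>)
  then have "AE x in M. eventually (\<lambda>n. x \<in> space M - D n) sequentially"
    by (intro borel_cantelli_AE1) (auto simp: emeasure_eq_measure)
  then obtain N where N: "N \<in> null_sets M" "{x\<in>space M. \<not> eventually (\<lambda>n. x \<in> space M - D n) sequentially} \<subseteq> N"
    unfolding eventually_ae_filter by blast
  \<comment> \<open>The limit superior of the \<open>C n\<close>. The errors are summable, so by
    Borel-Cantelli almost every point lies in only finitely many \<open>D n\<close>, and there
    \<open>C n\<close> eventually agrees with \<open>E\<close>.\<close>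
  define L where "L = (\<Inter>m. \<Union>n\<in>{m..}. C n)"
  have L: "L \<in> S" unfolding L_def by (intro S.countable_INT S.countable_UN') (use C in auto)
  have "(E - L) \<union> (L - E) \<subseteq> N"
  proof
    fix x assume x: "x \<in> (E - L) \<union> (L - E)"
    then have sp: "x \<in> space M" using sets.sets_into_space[OF E] S.sets_into_space[OF L] by blast
    show "x \<in> N"
    proof (rule ccontr)
      assume "x \<notin> N"
      then obtain m where m: "\<And>n. n \<ge> m \<Longrightarrow> x \<notin> D n"
        using N(2) sp unfolding eventually_sequentially by blast
      then have ev: "x \<in> C n \<longleftrightarrow> x \<in> E" if "n \<ge> m" for n using that by (auto simp: D_def)
      have "x \<in> L" if "x \<in> E"
        unfolding L_def
      proof (rule INT_I)
        fix i show "x \<in> (\<Union>n\<in>{i..}. C n)" using ev that by (intro UN_I[of "max m i"]) auto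
      qed
      moreover have "x \<in> E" if "x \<in> L"
      proof -
        from that obtain n where "n \<ge> m" "x \<in> C n" unfolding L_def by blast
        with ev show ?thesis by blast
      qed
      ultimately show False using x by auto
    qed
  qed
  then show ?thesis
    unfolding aug_null_def by (intro CollectI bexI[OF _ L] bexI[OF _ N(1)])
qed

section \<open>Monotone flows\<close>

definition pascal_step :: "(nat \<Rightarrow> real) \<Rightarrow> nat \<Rightarrow> real \<Rightarrow> nat" where
  "pascal_step p w u = (if u < p w then w - 1 else w)"

text \<open>The flow starts at \<open>w\<close> at depth \<open>k + d\<close> and reads
  \<open>u (k + d - 1)\<close>, ..., \<open>u k\<close> in this order, that is, forward in time. The
  recursion peels off the deepest step, so that an induction on \<open>d\<close> meets each
  innovation as the one to be absorbed into the past.\<close>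

primrec flow :: "(nat \<Rightarrow> nat \<Rightarrow> real) \<Rightarrow> (nat \<Rightarrow> real) \<Rightarrow> nat \<Rightarrow> nat \<Rightarrow> nat \<Rightarrow> nat" where
  "flow q u k 0 w = w"
| "flow q u k (Suc d) w = flow q u k d (pascal_step (q (k + d)) w (u (k + d)))"

text \<open>The threshold \<open>p\<close> may vary arbitrarily with the vertex: if
  \<open>w < w'\<close>, the lower vertex ends at most at \<open>w\<close> and the upper one at
  least at \<open>w' - 1\<close>.\<close>

lemma pascal_step_mono: "w \<le> w' \<Longrightarrow> pascal_step p w u \<le> pascal_step p w' u"
  by (cases "w = w'") (auto simp: pascal_step_def)

lemma flow_mono: "w \<le> w' \<Longrightarrow> flow q u k d w \<le> flow q u k d w'"
  by (induction d arbitrary: w w') (simp_all add: pascal_step_mono)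

section \<open>Processes driven by innovations\<close>

locale vertex_process = prob_space M for M :: "'a measure" +
  fixes V :: "nat \<Rightarrow> 'a \<Rightarrow> nat"
  assumes V_measurable[measurable]: "V k \<in> M \<rightarrow>\<^sub>M count_space UNIV"
begin

abbreviation "F k \<equiv> nat_filt M V k"

lemma F_events: "F k \<subseteq> events"
  unfolding nat_filt_def by (intro sa_fam_subset_sets) auto

lemma F_sigma_algebra: "sigma_algebra (space M) (F k)"
  unfolding nat_filt_def by (rule sa_fam_sigma_algebra)

lemma F_antimono: "j \<le> k \<Longrightarrow> F k \<subseteq> F j"
  unfolding nat_filt_def by (intro sa_fam_mono) auto

lemma V_in_F: "{x \<in> space M. P (V k x)} \<in> F k"
proof -
  have "{x \<in> space M. P (V k x)} \<in> sa_of (space M) (V k) (count_space UNIV)"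
    unfolding sa_of_def by (intro CollectI exI[of _ "{w. P w}"]) auto
  then show ?thesis
    unfolding nat_filt_def using sa_of_subset_sa_fam[of k "{k..}"] by blast
qed

end

text \<open>The interface between generation and immersion on one side and the construction of
  innovations on the other. Independence is from past vertices and past innovations jointly, and the
  recursion holds pointwise.\<close>

locale pascal_flow = vertex_process M V for M :: "'a measure" and V +
  fixes U :: "nat \<Rightarrow> 'a \<Rightarrow> real" and q :: "nat \<Rightarrow> nat \<Rightarrow> real"
  assumes U_measurable[measurable]: "U k \<in> borel_measurable M"
    and V_le: "x \<in> space M \<Longrightarrow> V k x \<le> k"
    and V_step: "x \<in> space M \<Longrightarrow> V k x = pascal_step (q k) (V (Suc k) x) (U k x)"
    and indep_innovation: "indep_set (sa_of (space M) (U k) borel)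
      (sigma_sets (space M) (nat_filt M V (Suc k) \<union> sa_fam (space M) U borel {Suc k..}))"
    and tail_trivial: "A \<in> (\<Inter>k. nat_filt M V k) \<Longrightarrow> prob A = 0 \<or> prob A = 1"
begin

abbreviation "G k \<equiv> sa_fam (space M) U borel {k..}"
abbreviation "H k \<equiv> sigma_sets (space M) (F k \<union> G k)"

lemma G_events: "G k \<subseteq> events"
  by (intro sa_fam_subset_sets) auto

lemma H_events: "H k \<subseteq> events"
  using F_events[of k] G_events[of k] by (intro sets.sigma_sets_subset) auto

lemma G_sigma_algebra: "sigma_algebra (space M) (G k)"
  by (rule sa_fam_sigma_algebra)

lemma H_sigma_algebra: "sigma_algebra (space M) (H k)"
  by (intro sigma_algebra_sigma_sets Un_least)
     (use F_sigma_algebra[of k] G_sigma_algebra[of k] in \<open>auto simp: sigma_algebra_iff2\<close>)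

lemma F_subset_H: "F k \<subseteq> H k" and G_subset_H: "G k \<subseteq> H k"
  by auto

lemma G_antimono: "j \<le> k \<Longrightarrow> G k \<subseteq> G j"
  by (intro sa_fam_mono) auto

lemma H_antimono: "j \<le> k \<Longrightarrow> H k \<subseteq> H j"
  by (intro sigma_sets_mono' Un_mono F_antimono G_antimono)

lemma U_in_G: "B \<in> sets borel \<Longrightarrow> {x \<in> space M. U k x \<in> B} \<in> G k"
proof -
  assume "B \<in> sets borel"
  then have "{x \<in> space M. U k x \<in> B} \<in> sa_of (space M) (U k) borel"
    unfolding sa_of_def by (intro CollectI exI[of _ B]) auto
  then show ?thesis
    using sa_of_subset_sa_fam[of k "{k..}" "space M" U borel] by blast
qed

lemma prob_innovation:
  assumes "B \<in> sets borel" "D \<in> H (Suc k)"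
  shows "prob ({x \<in> space M. U k x \<in> B} \<inter> D) = prob {x \<in> space M. U k x \<in> B} * prob D"
proof (rule indep_setD[OF indep_innovation])
  show "{x \<in> space M. U k x \<in> B} \<in> sa_of (space M) (U k) borel"
    using assms unfolding sa_of_def by (intro CollectI exI[of _ B]) auto
qed (use assms in auto)

section \<open>Flows from fixed vertices and conditional probabilities\<close>

definition above :: "nat \<Rightarrow> nat \<Rightarrow> nat \<Rightarrow> nat \<Rightarrow> 'a set" where
  "above k v d w = {x \<in> space M. v \<le> flow q (\<lambda>j. U j x) k d w}"

lemma above_Suc: "above k v (Suc d) w =
    ({x \<in> space M. U (k + d) x \<in> {..<q (k + d) w}} \<inter> above k v d (w - 1)) \<union>
    ({x \<in> space M. U (k + d) x \<in> {q (k + d) w..}} \<inter> above k v d w)"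
  by (auto simp: above_def pascal_step_def)

text \<open>With a deterministic start the flow is a function of the innovations alone; these events
  are the approximants of \<open>v \<le> V k\<close> within \<open>G k\<close>.\<close>

lemma above_in_G: "above k v d w \<in> G k"
proof (induction d arbitrary: w)
  case 0
  interpret sigma_algebra "space M" "G k" by (rule G_sigma_algebra)
  have "above k v 0 w = (if v \<le> w then space M else {})" by (auto simp: above_def)
  then show ?case by auto
next
  case (Suc d)
  interpret sigma_algebra "space M" "G k" by (rule G_sigma_algebra)
  have "{x \<in> space M. U (k + d) x \<in> B} \<in> G k" if "B \<in> sets borel" for B
    using U_in_G[OF that, of "k + d"] G_antimono[of k "k + d"] by auto
  from this[of "{..<q (k + d) w}"] this[of "{q (k + d) w..}"] show ?case
    unfolding above_Suc by (intro Un Int Suc) simp_all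
qed

lemma above_events[measurable]: "above k v d w \<in> events"
  using above_in_G G_events by blast

text \<open>Independence of a block of innovations from the joint past. \<open>D\<close> varies in
  the induction: the two outcomes of the deepest step are intersected with \<open>D\<close>, giving
  events of \<open>H (k + d)\<close> to which the induction hypothesis applies.\<close>

lemma prob_above_Int:
  "D \<in> H (k + d) \<Longrightarrow> prob (above k v d w \<inter> D) = prob (above k v d w) * prob D"
proof (induction d arbitrary: w D)
  case 0
  then have D: "D \<in> events" using H_events by blast
  have "above k v 0 w = (if v \<le> w then space M else {})" by (auto simp: above_def)
  then show ?case using D by (auto simp: prob_space)
next
  case (Suc d)
  interpret H: sigma_algebra "space M" "H (k + d)" by (rule H_sigma_algebra)
  let ?L = "{x \<in> space M. U (k + d) x \<in> {..<q (k + d) w}}"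
  let ?R = "{x \<in> space M. U (k + d) x \<in> {q (k + d) w..}}"
  have split: "prob (above k v (Suc d) w \<inter> D) =
      prob (above k v d (w - 1)) * (prob ?L * prob D) + prob (above k v d w) * (prob ?R * prob D)"
    if D: "D \<in> H (Suc (k + d))" for D
  proof -
    have DH: "D \<in> H (k + d)" using H_antimono[of "k + d" "Suc (k + d)"] D by auto
    have "B \<in> sets borel \<Longrightarrow> {x \<in> space M. U (k + d) x \<in> B} \<in> H (k + d)" for B
      using U_in_G G_subset_H by blast
    from this[of "{..<q (k + d) w}"] this[of "{q (k + d) w..}"]
    have LD: "?L \<inter> D \<in> H (k + d)" and RD: "?R \<inter> D \<in> H (k + d)" using DH by (simp_all add: H.Int)
    have "prob (above k v (Suc d) w \<inter> D) =
        prob ((above k v d (w - 1) \<inter> (?L \<inter> D)) \<union> (above k v d w \<inter> (?R \<inter> D)))"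
      unfolding above_Suc by (rule arg_cong[where f=prob]) auto
    also have "\<dots> = prob (above k v d (w - 1) \<inter> (?L \<inter> D)) + prob (above k v d w \<inter> (?R \<inter> D))"
    proof (intro finite_measure_Union sets.Int[OF above_events])
      show "?L \<inter> D \<in> events" "?R \<inter> D \<in> events" using LD RD H_events by blast+
    qed auto
    also have "\<dots> = prob (above k v d (w - 1)) * prob (?L \<inter> D) + prob (above k v d w) * prob (?R \<inter> D)"
      using Suc.IH[OF LD, of "w - 1"] Suc.IH[OF RD, of w] by presburger
    also have "\<dots> = prob (above k v d (w - 1)) * (prob ?L * prob D) + prob (above k v d w) * (prob ?R * prob D)"
      using prob_innovation[OF _ D, of "{..<q (k + d) w}"] prob_innovation[OF _ D, of "{q (k + d) w..}"] by simp
    finally show ?thesis .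
  qed
  \<comment> \<open>Using \<open>split\<close> for the whole space as well identifies the factor of
    \<open>prob D\<close> as the probability of \<open>above k v (Suc d) w\<close>.\<close>
  have "space M \<in> H (Suc (k + d))" by (simp add: sigma_sets_top)
  from split[OF this] have "prob (above k v (Suc d) w) =
      prob (above k v d (w - 1)) * prob ?L + prob (above k v d w) * prob ?R"
    using above_events[THEN sets.sets_into_space] by (simp add: prob_space Int_absorb2)
  then show ?case using split[of D] Suc.prems by (simp add: algebra_simps)
qed

lemma V_eq_flow: "x \<in> space M \<Longrightarrow> V k x = flow q (\<lambda>j. U j x) k d (V (k + d) x)"
  by (induction d) (auto simp: V_step[symmetric])

text \<open>A version of the conditional probability of \<open>v \<le> V k\<close> given
  \<open>H (k + d)\<close>; being a function of \<open>V (k + d)\<close>, it is also one given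
  \<open>F (k + d)\<close>.\<close>

definition survival :: "nat \<Rightarrow> nat \<Rightarrow> nat \<Rightarrow> 'a \<Rightarrow> real" where
  "survival k v d x = prob (above k v d (V (k + d) x))"

lemma survival_measurable_F: "survival k v d \<in> borel_measurable (sigma (space M) (F (k + d)))"
proof -
  have "V (k + d) \<in> sigma (space M) (F (k + d)) \<rightarrow>\<^sub>M count_space UNIV"
    unfolding nat_filt_def by (rule measurable_sa_fam) auto
  then show ?thesis unfolding survival_def by measurable
qed

lemma survival_measurable[measurable]: "survival k v d \<in> borel_measurable M"
  unfolding survival_def by measurable

lemma survival_bounds: "0 \<le> survival k v d x" "survival k v d x \<le> 1"
  by (auto simp: survival_def)

lemma survival_integrable: "integrable M (survival k v d)"
  by (rule integrable_const_bound[where B=1]) (auto simp: survival_bounds)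

lemma prob_ge_Int_eq_integral_survival:
  assumes D: "D \<in> H (k + d)"
  shows "prob ({x \<in> space M. v \<le> V k x} \<inter> D) = (\<integral>x. indicator D x * survival k v d x \<partial>M)"
proof -
  interpret H: sigma_algebra "space M" "H (k + d)" by (rule H_sigma_algebra)
  define D' where "D' w = {x \<in> space M. V (k + d) x = w} \<inter> D" for w
  have D'H: "D' w \<in> H (k + d)" for w
    unfolding D'_def using V_in_F[of "\<lambda>y. y = w"] F_subset_H D by blast
  then have [measurable]: "D' w \<in> events" for w using H_events by blast
  \<comment> \<open>At depth \<open>k + d\<close> only finitely many vertices occur. On the piece
    where \<open>V (k + d) = w\<close> the random start may be replaced by \<open>w\<close>, and the
    flow from \<open>w\<close> is independent of the piece.\<close>
  have "prob ({x \<in> space M. v \<le> V k x} \<inter> D) = prob (\<Union>w\<in>{..k + d}. above k v d w \<inter> D' w)"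
    by (rule arg_cong[where f=prob]) (use V_le V_eq_flow[of _ k d] H.sets_into_space[OF D] in \<open>auto simp: above_def D'_def\<close>)
  also have "\<dots> = (\<Sum>w\<le>k + d. prob (above k v d w \<inter> D' w))"
  proof (intro finite_measure_finite_Union)
    show "disjoint_family_on (\<lambda>w. above k v d w \<inter> D' w) {..k + d}"
      by (auto simp: disjoint_family_on_def D'_def)
  qed auto
  also have "\<dots> = (\<Sum>w\<le>k + d. \<integral>x. indicator (D' w) x * prob (above k v d w) \<partial>M)"
    by (intro sum.cong refl) (simp add: prob_above_Int[OF D'H])
  also have "\<dots> = (\<integral>x. (\<Sum>w\<le>k + d. indicator (D' w) x * prob (above k v d w)) \<partial>M)"
    by (intro Bochner_Integration.integral_sum[symmetric] integrable_mult_left)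
       (simp add: integrable_indicator_iff emeasure_eq_measure)
  also have "\<dots> = (\<integral>x. indicator D x * survival k v d x \<partial>M)"
  proof (intro Bochner_Integration.integral_cong refl)
    fix x assume x: "x \<in> space M"
    have "(\<Sum>w\<le>k + d. indicator (D' w) x * prob (above k v d w)) =
        (\<Sum>w\<le>k + d. if w = V (k + d) x then indicator D x * prob (above k v d w) else 0)"
      using x by (intro sum.cong refl) (auto simp: D'_def indicator_def)
    also have "\<dots> = indicator D x * survival k v d x"
      using V_le[OF x, of "k + d"] by (simp add: survival_def)
    finally show "(\<Sum>w\<le>k + d. indicator (D' w) x * prob (above k v d w)) = indicator D x * survival k v d x" .
  qed
  finally show ?thesis .
qed

subsection \<open>Reverse martingale convergence\<close>

lemma integral_survival_eq: "(\<integral>x. survival k v d x \<partial>M) = prob {x \<in> space M. v \<le> V k x}"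
proof -
  have "(\<integral>x. survival k v d x \<partial>M) = (\<integral>x. indicator (space M) x * survival k v d x \<partial>M)"
    by (intro Bochner_Integration.integral_cong) auto
  also have "\<dots> = prob ({x \<in> space M. v \<le> V k x} \<inter> space M)"
    by (rule prob_ge_Int_eq_integral_survival[symmetric]) (simp add: sigma_sets_top)
  finally show ?thesis by (simp add: Int_absorb2 subset_eq)
qed

text \<open>The point is that the right-hand side does not involve \<open>d\<close>. The mixed
  moment thus equals the second moment at \<open>e\<close>, which is the orthogonality of martingale
  increments.\<close>

lemma integral_survival_mult:
  assumes "d \<le> e"
  shows "(\<integral>x. survival k v e x * survival k v d x \<partial>M) =
    (\<Sum>w\<le>k + e. prob (above k v e w) * prob ({x \<in> space M. v \<le> V k x} \<inter> {x \<in> space M. V (k + e) x = w}))"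
proof -
  let ?D = "\<lambda>w. {x \<in> space M. V (k + e) x = w}"
  have DH: "?D w \<in> H (k + d)" for w
  proof -
    have "?D w \<in> H (k + e)" using V_in_F[of "\<lambda>y. y = w" "k + e"] F_subset_H by blast
    then show ?thesis using H_antimono[of "k + d" "k + e"] assms by auto
  qed
  have eq: "survival k v e x * survival k v d x =
      (\<Sum>w\<le>k + e. prob (above k v e w) * (indicator (?D w) x * survival k v d x))"
    if x: "x \<in> space M" for x
  proof -
    have "(\<Sum>w\<le>k + e. prob (above k v e w) * (indicator (?D w) x * survival k v d x)) =
        (\<Sum>w\<le>k + e. if w = V (k + e) x then prob (above k v e w) * survival k v d x else 0)"
      using x by (intro sum.cong refl) (auto simp: indicator_def)
    also have "\<dots> = survival k v e x * survival k v d x"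
      using V_le[OF x, of "k + e"] by (simp add: survival_def)
    finally show ?thesis by simp
  qed
  have int: "integrable M (\<lambda>x. indicator (?D w) x * survival k v d x)" for w
    by (rule integrable_const_bound[where B=1]) (auto simp: survival_bounds indicator_def)
  have "(\<integral>x. survival k v e x * survival k v d x \<partial>M) =
     (\<integral>x. (\<Sum>w\<le>k + e. prob (above k v e w) * (indicator (?D w) x * survival k v d x)) \<partial>M)"
    by (intro Bochner_Integration.integral_cong refl eq)
  also have "\<dots> = (\<Sum>w\<le>k + e. prob (above k v e w) * (\<integral>x. indicator (?D w) x * survival k v d x \<partial>M))"
    by (subst Bochner_Integration.integral_sum) (use int in auto)
  finally show ?thesis
    by (simp only: prob_ge_Int_eq_integral_survival[OF DH])
qed

lemma survival_mult_integrable: "integrable M (\<lambda>x. survival k v e x * survival k v d x)"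
  by (rule integrable_const_bound[where B=1])
     (auto simp: survival_bounds mult_le_one abs_mult)

lemma integral_survival_diff_sq:
  assumes "d \<le> e"
  shows "(\<integral>x. (survival k v d x - survival k v e x)\<^sup>2 \<partial>M) =
    (\<integral>x. (survival k v d x)\<^sup>2 \<partial>M) - (\<integral>x. (survival k v e x)\<^sup>2 \<partial>M)"
proof -
  have "(\<integral>x. (survival k v d x - survival k v e x)\<^sup>2 \<partial>M) =
    (\<integral>x. survival k v d x * survival k v d x + survival k v e x * survival k v e x
        - 2 * (survival k v e x * survival k v d x) \<partial>M)"
    by (intro Bochner_Integration.integral_cong refl) (simp add: power2_eq_square algebra_simps)
  also have "\<dots> = (\<integral>x. survival k v d x * survival k v d x \<partial>M) + (\<integral>x. survival k v e x * survival k v e x \<partial>M)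
      - 2 * (\<integral>x. survival k v e x * survival k v d x \<partial>M)"
    by (simp add: survival_mult_integrable)
  also have "(\<integral>x. survival k v e x * survival k v d x \<partial>M) = (\<integral>x. survival k v e x * survival k v e x \<partial>M)"
    by (simp only: integral_survival_mult[OF assms] integral_survival_mult[OF order.refl])
  finally show ?thesis by (simp add: power2_eq_square)
qed

text \<open>Passage from \<open>L^2\<close> to \<open>L^1\<close>, by the arithmetic-geometric
  inequality with weight \<open>e\<close> in place of Cauchy-Schwarz.\<close>

lemma integral_abs_less:
  fixes f :: "'a \<Rightarrow> real"
  assumes f: "integrable M f" "integrable M (\<lambda>x. (f x)\<^sup>2)" and e: "e > 0" "(\<integral>x. (f x)\<^sup>2 \<partial>M) < e\<^sup>2"
  shows "(\<integral>x. \<bar>f x\<bar> \<partial>M) < e"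
proof -
  have "\<bar>f x\<bar> \<le> ((f x)\<^sup>2 / e + e) / 2" for x
  proof -
    have "0 \<le> (\<bar>f x\<bar> - e)\<^sup>2" by simp
    then have "2 * e * \<bar>f x\<bar> \<le> (f x)\<^sup>2 + e\<^sup>2" by (simp add: power2_diff algebra_simps)
    then show ?thesis using e(1) by (simp add: field_simps power2_eq_square)
  qed
  then have "(\<integral>x. \<bar>f x\<bar> \<partial>M) \<le> (\<integral>x. ((f x)\<^sup>2 / e + e) / 2 \<partial>M)"
    using f by (intro integral_mono) auto
  also have "\<dots> = ((\<integral>x. (f x)\<^sup>2 \<partial>M) / e + e) / 2"
    using f by (simp add: prob_space)
  also have "\<dots> < e"
    using e by (simp add: field_simps power2_eq_square)
  finally show ?thesis .
qed

text \<open>By orthogonality the squared \<open>L^2\<close> distance of two terms is the difference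
  of their second moments. These decrease in \<open>d\<close> and are nonnegative, hence form a
  Cauchy sequence.\<close>

lemma survival_L1_Cauchy:
  assumes "e > 0"
  shows "\<exists>N. \<forall>i\<ge>N. \<forall>j\<ge>N. (\<integral>x. norm (survival k v i x - survival k v j x) \<partial>M) < e"
proof -
  define c where "c d = (\<integral>x. (survival k v d x)\<^sup>2 \<partial>M)" for d
  have "c e \<le> c d" if "d \<le> e" for d e
    using integral_survival_diff_sq[OF that, of k v]
      Bochner_Integration.integral_nonneg[of M "\<lambda>x. (survival k v d x - survival k v e x)\<^sup>2"]
    by (simp add: c_def)
  then have "decseq c" by (simp add: decseq_def)
  moreover have "c d \<ge> 0" for d by (simp add: c_def)
  ultimately have "convergent c" using decseq_convergent[of c 0] by (metis convergentI)
  then have "Cauchy c" by (simp add: Cauchy_convergent_iff)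
  then obtain N where N: "\<And>i j. i \<ge> N \<Longrightarrow> j \<ge> N \<Longrightarrow> \<bar>c i - c j\<bar> < e\<^sup>2"
    using assms metric_CauchyD[of c "e\<^sup>2"] by (auto simp: dist_real_def)
  have less: "(\<integral>x. \<bar>survival k v i x - survival k v j x\<bar> \<partial>M) < e" if "i \<ge> N" "j \<ge> N" "i \<le> j" for i j
  proof (rule integral_abs_less)
    show "integrable M (\<lambda>x. (survival k v i x - survival k v j x)\<^sup>2)"
    proof (rule integrable_const_bound[where B=1])
      have "\<bar>survival k v i x - survival k v j x\<bar> \<le> 1" for x
        using survival_bounds[of k v i x] survival_bounds[of k v j x] by linarith
      then show "AE x in M. norm ((survival k v i x - survival k v j x)\<^sup>2) \<le> 1"
        by (simp add: abs_square_le_1)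
    qed simp
    show "(\<integral>x. (survival k v i x - survival k v j x)\<^sup>2 \<partial>M) < e\<^sup>2"
      unfolding integral_survival_diff_sq[OF that(3)] using N[OF that(1,2)] by (simp add: c_def)
  qed (use assms survival_integrable in auto)
  have "(\<integral>x. \<bar>survival k v i x - survival k v j x\<bar> \<partial>M) < e" if "i \<ge> N" "j \<ge> N" for i j
    using less[of i j] less[of j i] that by (cases "i \<le> j") (auto simp: abs_minus_commute)
  then show ?thesis by auto
qed

text \<open>A single tail event suffices: according to whether \<open>L x < expectation L\<close>
  has probability 0 or 1, \<open>L\<close> lies almost surely on one side of its mean, and a
  variable on one side of its mean equals it.\<close>

lemma tail_measurable_const:
  fixes L :: "'a \<Rightarrow> real"
  assumes tail: "\<And>m. L \<in> borel_measurable (sigma (space M) (F m))" and int: "integrable M L"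
  shows "AE x in M. L x = expectation L"
proof -
  define A where "A = {x \<in> space M. L x < expectation L}"
  have "A \<in> F m" for m
  proof -
    have "A \<in> sets (sigma (space M) (F m))"
      using measurable_sets[OF tail[of m], of "{..<expectation L}"]
      by (simp add: A_def vimage_def Int_def conj_commute space_measure_of_conv)
    then show ?thesis by (simp add: sigma_algebra.sets_measure_of_eq[OF F_sigma_algebra])
  qed
  then have A: "prob A = 0 \<or> prob A = 1" "A \<in> events" using tail_trivial[of A] F_events by auto
  have [measurable]: "L \<in> borel_measurable M" using int by simp
  have ae: "AE x in M. L x = expectation L" if "(AE x in M. L x \<le> expectation L) \<or> (AE x in M. expectation L \<le> L x)"
    using that
  proof
    assume le: "AE x in M. L x \<le> expectation L"
    have "AE x in M. expectation L - L x = 0"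
      by (rule integral_nonneg_eq_0_iff_AE[THEN iffD1]) (use le int in \<open>auto simp: prob_space\<close>)
    then show ?thesis by auto
  next
    assume le: "AE x in M. expectation L \<le> L x"
    have "AE x in M. L x - expectation L = 0"
      by (rule integral_nonneg_eq_0_iff_AE[THEN iffD1]) (use le int in \<open>auto simp: prob_space\<close>)
    then show ?thesis by auto
  qed
  from A(1) show ?thesis
  proof
    assume "prob A = 0"
    then have "AE x in M. x \<notin> A" using A(2) prob_eq_0 by blast
    then have "AE x in M. expectation L \<le> L x" by (auto simp: A_def not_less)
    then show ?thesis using ae by blast
  next
    assume "prob A = 1"
    then have "AE x in M. x \<in> A" using A(2) prob_eq_1 by blast
    then have "AE x in M. L x \<le> expectation L" by (auto simp: A_def)
    then show ?thesis using ae by blast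
  qed
qed

lemma survival_L1_approx:
  assumes "e > 0"
  shows "\<exists>d. (\<integral>x. \<bar>survival k v d x - prob {x \<in> space M. v \<le> V k x}\<bar> \<partial>M) < e"
proof -
  let ?p = "prob {x \<in> space M. v \<le> V k x}"
  \<comment> \<open>A subsequence is enough, because a single good \<open>d\<close> is wanted in the
    end.\<close>
  obtain r where r: "strict_mono r" "AE x in M. Cauchy (\<lambda>i. survival k v (r i) x)"
    by (rule cauchy_L1_AE_cauchy_subseq[OF survival_integrable survival_L1_Cauchy])
  define L where "L x = lim (\<lambda>i. survival k v (r i) x)" for x
  have L[measurable]: "L \<in> borel_measurable M" unfolding L_def by measurable
  have lim: "AE x in M. (\<lambda>i. survival k v (r i) x) \<longlonglongrightarrow> L x"
    using r(2) by eventually_elim (simp add: L_def Cauchy_convergent_iff convergent_LIMSEQ_iff)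
  have bound: "AE x in M. norm (L x) \<le> 1"
    using lim
  proof eventually_elim
    fix x assume l: "(\<lambda>i. survival k v (r i) x) \<longlonglongrightarrow> L x"
    have "0 \<le> L x" using LIMSEQ_le_const[OF l] survival_bounds by blast
    moreover have "L x \<le> 1" using LIMSEQ_le_const2[OF l] survival_bounds by blast
    ultimately show "norm (L x) \<le> 1" by simp
  qed
  have Lint: "integrable M L" by (rule integrable_const_bound[OF bound L])
  have "L \<in> borel_measurable (sigma (space M) (F m))" for m
  proof -
    \<comment> \<open>Dropping the first \<open>m\<close> terms leaves only functions measurable for
      \<open>F m\<close>. The equality holds for divergent sequences too, where both sides are the
      same unspecified value, so \<open>L\<close> is tail measurable without an exceptional
      set.\<close>
    have shift: "lim X = lim (\<lambda>i. X (i + m))" for X :: "nat \<Rightarrow> real"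
    proof -
      have "X \<longlonglongrightarrow> l \<longleftrightarrow> (\<lambda>i. X (i + m)) \<longlonglongrightarrow> l" for l
        using LIMSEQ_ignore_initial_segment[of X l m] LIMSEQ_offset[of X m l] by blast
      then show ?thesis unfolding lim_def by simp
    qed
    have "L = (\<lambda>x. lim (\<lambda>i. survival k v (r (i + m)) x))"
      unfolding L_def by (intro ext shift)
    moreover have "survival k v (r (i + m)) \<in> borel_measurable (sigma (space M) (F m))" for i
    proof -
      have "m \<le> k + r (i + m)" using seq_suble[OF r(1), of "i + m"] by simp
      moreover have "F m \<subseteq> Pow (space M)" unfolding nat_filt_def by (rule sa_fam_subset_Pow)
      ultimately have "borel_measurable (sigma (space M) (F (k + r (i + m)))) \<subseteq>
          (borel_measurable (sigma (space M) (F m)) :: ('a \<Rightarrow> real) set)"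
        by (intro measurable_mono1 F_antimono)
      then show ?thesis using survival_measurable_F by blast
    qed
    ultimately show ?thesis by simp
  qed
  then have const: "AE x in M. L x = expectation L" by (rule tail_measurable_const[OF _ Lint])
  \<comment> \<open>Identifies the constant: all terms have the same mean, and bounded convergence
    hands it to the limit.\<close>
  have "(\<lambda>i. \<integral>x. survival k v (r i) x \<partial>M) \<longlonglongrightarrow> expectation L"
    by (rule integral_dominated_convergence[where w="\<lambda>_. 1"]) (use lim in \<open>auto simp: survival_bounds\<close>)
  then have EL: "expectation L = ?p"
    using LIMSEQ_unique[OF _ tendsto_const] by (simp add: integral_survival_eq)
  have "(\<lambda>i. \<integral>x. \<bar>survival k v (r i) x - ?p\<bar> \<partial>M) \<longlonglongrightarrow> (\<integral>x. 0 \<partial>M)"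
  proof (rule integral_dominated_convergence[where w="\<lambda>_. 2"])
    show "AE x in M. (\<lambda>i. \<bar>survival k v (r i) x - ?p\<bar>) \<longlonglongrightarrow> 0"
      using lim const
    proof eventually_elim
      fix x assume "(\<lambda>i. survival k v (r i) x) \<longlonglongrightarrow> L x" "L x = expectation L"
      then have "(\<lambda>i. survival k v (r i) x - ?p) \<longlonglongrightarrow> 0"
        using EL by (simp add: LIM_zero_iff)
      then show "(\<lambda>i. \<bar>survival k v (r i) x - ?p\<bar>) \<longlonglongrightarrow> 0" by (rule tendsto_rabs_zero)
    qed
    show "AE x in M. norm \<bar>survival k v (r i) x - ?p\<bar> \<le> 2" for i
      using survival_bounds[of k v "r i"] prob_le_1[of "{x \<in> space M. v \<le> V k x}"]
        measure_nonneg[of M "{x \<in> space M. v \<le> V k x}"]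
      by (intro AE_I2) (smt (verit) real_norm_def)
  qed auto
  then have "(\<lambda>i. \<integral>x. \<bar>survival k v (r i) x - ?p\<bar> \<partial>M) \<longlonglongrightarrow> 0" by simp
  then have "eventually (\<lambda>i. (\<integral>x. \<bar>survival k v (r i) x - ?p\<bar> \<partial>M) < e) sequentially"
    using assms by (rule order_tendstoD(2))
  then show ?thesis by (auto simp: eventually_sequentially)
qed

subsection \<open>Generation by the innovations\<close>

text \<open>Monotonicity of the flow nests the two events on either side of \<open>V (k + d) = w\<close>.\<close>

lemma prob_sym_diff_above_le:
  fixes k v d w
  defines "E \<equiv> {x \<in> space M. v \<le> V k x}"
  shows "prob ((E - above k v d w) \<union> (above k v d w - E)) \<le> (\<integral>x. \<bar>survival k v d x - prob (above k v d w)\<bar> \<partial>M)"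
proof -
  let ?B = "above k v d w" and ?s = "prob (above k v d w)"
  define A where "A = {x \<in> space M. w \<le> V (k + d) x}"
  have "A \<in> F (k + d)" unfolding A_def by (rule V_in_F)
  then have AH: "A \<in> H (k + d)" using F_subset_H by blast
  interpret H: sigma_algebra "space M" "H (k + d)" by (rule H_sigma_algebra)
  have CH: "space M - A \<in> H (k + d)" using AH by (rule H.compl_sets)
  have [measurable]: "E \<in> events" "A \<in> events" unfolding E_def A_def by measurable
  have eq: "(E - ?B) \<union> (?B - E) = ((E \<inter> A) - (?B \<inter> A)) \<union> ((?B \<inter> (space M - A)) - (E \<inter> (space M - A)))"
    and sub: "?B \<inter> A \<subseteq> E \<inter> A" "E \<inter> (space M - A) \<subseteq> ?B \<inter> (space M - A)"
  proof -
    have 1: "x \<in> E" if "x \<in> ?B" "x \<in> A" for x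
      using that flow_mono[of w "V (k + d) x" q "\<lambda>j. U j x" k d] V_eq_flow[of x k d]
      by (auto simp: E_def A_def above_def)
    have 2: "x \<in> ?B" if "x \<in> E" "x \<notin> A" for x
      using that flow_mono[of "V (k + d) x" w q "\<lambda>j. U j x" k d] V_eq_flow[of x k d]
      by (auto simp: E_def A_def above_def)
    have sp: "E \<subseteq> space M" "?B \<subseteq> space M" by (auto simp: E_def above_def)
    show "(E - ?B) \<union> (?B - E) = ((E \<inter> A) - (?B \<inter> A)) \<union> ((?B \<inter> (space M - A)) - (E \<inter> (space M - A)))"
      "?B \<inter> A \<subseteq> E \<inter> A" "E \<inter> (space M - A) \<subseteq> ?B \<inter> (space M - A)"
      using 1 2 sp by blast+
  qed
  have int: "integrable M (\<lambda>x. indicator D x * survival k v d x)" "integrable M (indicator D :: 'a \<Rightarrow> real)"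
    if "D \<in> events" for D
    using that by (auto intro!: integrable_const_bound[where B=1] simp: survival_bounds indicator_def)
  have "prob ((E - ?B) \<union> (?B - E)) =
      prob ((E \<inter> A) - (?B \<inter> A)) + prob ((?B \<inter> (space M - A)) - (E \<inter> (space M - A)))"
    unfolding eq by (rule finite_measure_Union) auto
  also have "\<dots> = (prob (E \<inter> A) - prob (?B \<inter> A)) + (prob (?B \<inter> (space M - A)) - prob (E \<inter> (space M - A)))"
    by (intro arg_cong2[where f="(+)"] finite_measure_Diff sub) auto
  also have "\<dots> = ((\<integral>x. indicator A x * survival k v d x \<partial>M) - ?s * (\<integral>x. indicator A x \<partial>M)) +
      (?s * (\<integral>x. indicator (space M - A) x \<partial>M) - (\<integral>x. indicator (space M - A) x * survival k v d x \<partial>M))"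
    unfolding E_def prob_ge_Int_eq_integral_survival[OF AH] prob_ge_Int_eq_integral_survival[OF CH]
      prob_above_Int[OF AH] prob_above_Int[OF CH] by simp
  also have "\<dots> = (\<integral>x. (indicator A x * survival k v d x - ?s * indicator A x) +
      (?s * indicator (space M - A) x - indicator (space M - A) x * survival k v d x) \<partial>M)"
    by (simp add: int)
  \<comment> \<open>On \<open>A\<close> the integrand is \<open>survival k v d x - ?s\<close> and
    off \<open>A\<close> its negative; both are bounded by the absolute value.\<close>
  also have "\<dots> \<le> (\<integral>x. \<bar>survival k v d x - ?s\<bar> \<partial>M)"
  proof (rule integral_mono)
    show "(indicator A x * survival k v d x - ?s * indicator A x) +
      (?s * indicator (space M - A) x - indicator (space M - A) x * survival k v d x) \<le> \<bar>survival k v d x - ?s\<bar>" for x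
      by (auto simp: indicator_def)
  qed (simp_all add: int survival_integrable)
  finally show ?thesis .
qed

lemma ge_in_aug_null_G: "{x \<in> space M. v \<le> V k x} \<in> aug_null M (G k)"
proof (rule approx_imp_aug_null[OF G_sigma_algebra G_events])
  let ?E = "{x \<in> space M. v \<le> V k x}"
  show "?E \<in> events" by measurable
  fix e :: real assume "e > 0"
  then obtain d where d: "(\<integral>x. \<bar>survival k v d x - prob ?E\<bar> \<partial>M) < e / 2"
    using survival_L1_approx[of "e / 2" k v] by auto
  let ?f = "\<lambda>x. \<bar>survival k v d x - prob ?E\<bar>"
  have f: "integrable M ?f" using survival_integrable by simp
  \<comment> \<open>A function cannot exceed its mean everywhere on a probability space. The vertex
    of \<open>x\<close> at depth \<open>k + d\<close> is the deterministic start; one half of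
    \<open>e\<close> pays for the mean of \<open>?f\<close>, the other for
    \<open>?f x\<close>.\<close>
  obtain x where x: "x \<in> space M" "?f x \<le> (\<integral>x. ?f x \<partial>M)"
  proof (rule ccontr)
    assume "\<not> thesis"
    then have less: "(\<integral>x. ?f x \<partial>M) < ?f x" if "x \<in> space M" for x
      using that \<open>\<And>x. \<lbrakk>x \<in> space M; ?f x \<le> (\<integral>x. ?f x \<partial>M)\<rbrakk> \<Longrightarrow> thesis\<close> by force
    have "(\<integral>x. (\<integral>y. ?f y \<partial>M) \<partial>M) < (\<integral>x. ?f x \<partial>M)"
      by (rule integral_less_AE_space) (use f less in \<open>auto simp: emeasure_space_1\<close>)
    then show False by (simp add: prob_space)
  qed
  let ?B = "above k v d (V (k + d) x)"
  have "prob ((?E - ?B) \<union> (?B - ?E)) \<le> (\<integral>y. \<bar>survival k v d y - prob ?B\<bar> \<partial>M)"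
    by (rule prob_sym_diff_above_le)
  also have "\<dots> \<le> (\<integral>y. ?f y + ?f x \<partial>M)"
  proof (rule integral_mono)
    show "\<bar>survival k v d y - prob ?B\<bar> \<le> ?f y + ?f x" for y by (simp add: survival_def)
  qed (simp_all add: survival_integrable f)
  also have "\<dots> = (\<integral>y. ?f y \<partial>M) + ?f x"
    by (simp add: f survival_integrable prob_space)
  also have "\<dots> < e" using d x(2) by simp
  finally show "\<exists>C\<in>G k. prob ((?E - C) \<union> (C - ?E)) < e" using above_in_G by blast
qed

lemma F_subset_aug_null_G: "F k \<subseteq> aug_null M (G k)"
  unfolding nat_filt_def
proof (rule sa_fam_subset)
  show sa: "sigma_algebra (space M) (aug_null M (G k))"
    by (rule aug_null_sigma_algebra[OF G_sigma_algebra])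
  interpret sigma_algebra "space M" "aug_null M (G k)" by fact
  fix j assume "j \<in> {k..}"
  then have ge: "{x \<in> space M. v \<le> V j x} \<in> aug_null M (G k)" for v
    using ge_in_aug_null_G[of v j] aug_null_mono[OF G_antimono[of k j]] by auto
  have eq: "{x \<in> space M. V j x = w} \<in> aug_null M (G k)" for w
  proof -
    have "{x \<in> space M. V j x = w} = {x \<in> space M. w \<le> V j x} - {x \<in> space M. Suc w \<le> V j x}" by auto
    then show ?thesis using ge by auto
  qed
  show "sa_of (space M) (V j) (count_space UNIV) \<subseteq> aug_null M (G k)"
  proof
    fix B assume "B \<in> sa_of (space M) (V j) (count_space UNIV)"
    then obtain W where "B = V j -` W \<inter> space M" by (auto simp: sa_of_def)
    then have "B = (\<Union>w\<in>W. {x \<in> space M. V j x = w})" by auto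
    then show "B \<in> aug_null M (G k)" using countable_UN'[of W] eq by (simp add: image_subset_iff)
  qed
qed

text \<open>The induction adds the smallest depth, which is the latest time: the events already
  treated then lie in \<open>H (Suc k)\<close>, from which \<open>U k\<close> is
  independent.\<close>

lemma indep_vars_U: "indep_vars (\<lambda>_. borel) U UNIV"
  unfolding indep_vars_def2
proof (intro conjI ballI indep_setsI)
  fix A :: "nat \<Rightarrow> 'a set" and J :: "nat set"
  assume "finite J" "\<forall>j\<in>J. A j \<in> {U j -` B \<inter> space M |B. B \<in> sets borel}"
  then have "prob (\<Inter>j\<in>J. A j) = (\<Prod>j\<in>J. prob (A j))" if "J \<noteq> {}"
    using that
  proof (induction J rule: finite_linorder_min_induct)
    case (insert k J)
    have "\<exists>B. A j = {x \<in> space M. U j x \<in> B} \<and> B \<in> sets borel" if jJ: "j \<in> insert k J" for j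
    proof -
      obtain B where "A j = U j -` B \<inter> space M" "B \<in> sets borel" using bspec[OF insert.prems(1) jJ] by auto
      then show ?thesis by (intro exI[of _ B]) auto
    qed
    note vim = this
    obtain B where B: "A k = {x \<in> space M. U k x \<in> B}" "B \<in> sets borel"
      using vim[of k] by auto
    show ?case
    proof (cases "J = {}")
      case False
      interpret sigma_algebra "space M" "H (Suc k)" by (rule H_sigma_algebra)
      have "A j \<in> H (Suc k)" if j: "j \<in> J" for j
      proof -
        obtain B' where "A j = {x \<in> space M. U j x \<in> B'}" "B' \<in> sets borel"
          using vim[of j] j by auto
        then have "A j \<in> G j" using U_in_G by simp
        then show ?thesis using G_antimono[of "Suc k" j] G_subset_H[of "Suc k"] insert.hyps(2) j by fastforce
      qed
      then have "(\<Inter>j\<in>J. A j) \<in> H (Suc k)" using False insert.hyps(1) by (intro finite_INT) auto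
      then have "prob (A k \<inter> (\<Inter>j\<in>J. A j)) = prob (A k) * prob (\<Inter>j\<in>J. A j)"
        unfolding B(1) by (rule prob_innovation[OF B(2)])
      moreover have "k \<notin> J" using insert.hyps(2) by auto
      ultimately show ?thesis using insert False by simp
    qed simp
  qed simp
  then show "J \<noteq> {} \<Longrightarrow> prob (\<Inter>j\<in>J. A j) = (\<Prod>j\<in>J. prob (A j))" .
qed auto

subsection \<open>Immersion\<close>

lemma U_event: "B \<in> sets borel \<Longrightarrow> {x \<in> space M. U k x \<in> B} \<in> events"
  using U_in_G G_events by blast

lemma sigma_F_innovation_Pow:
  "F (Suc k) \<union> sa_of (space M) (U k) borel \<subseteq> Pow (space M)"
  unfolding nat_filt_def using sa_fam_subset_Pow[of "space M" V] sa_of_subset_Pow[of "space M" "U k"] by blast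

text \<open>Holds without null sets because the recursion is pointwise. It gives the
  parameterization property and also reduces immersion to adjoining \<open>U k\<close> to
  \<open>F (Suc k)\<close>.\<close>

lemma F_subset_sigma_F_innovation:
  "F k \<subseteq> sigma_sets (space M) (F (Suc k) \<union> sa_of (space M) (U k) borel)"
proof -
  let ?S = "F (Suc k) \<union> sa_of (space M) (U k) borel"
  have sa: "sigma_algebra (space M) (sigma_sets (space M) ?S)"
    by (rule sigma_algebra_sigma_sets[OF sigma_F_innovation_Pow])
  have sets_eq: "sets (sigma (space M) (sigma_sets (space M) ?S)) = sets (sigma (space M) ?S)"
    unfolding sigma_algebra.sets_measure_of_eq[OF sa] sets_measure_of[OF sigma_F_innovation_Pow] ..
  have sub: "sa_of (space M) (V j) (count_space UNIV) \<subseteq> sigma_sets (space M) ?S" if "j \<ge> Suc k" for j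
    using sa_of_subset_sa_fam[of j "{Suc k..}" "space M" V "count_space UNIV"] that
    unfolding nat_filt_def by auto
  have [measurable]: "U k \<in> borel_measurable (sigma (space M) ?S)"
    using sigma_F_innovation_Pow[of k]
    by (intro measurableI) (auto simp: sets_measure_of sa_of_def space_measure_of_conv)
  have [measurable]: "V (Suc k) \<in> sigma (space M) ?S \<rightarrow>\<^sub>M count_space UNIV"
    using sigma_F_innovation_Pow[of k] sub[of "Suc k"]
    by (intro measurableI) (auto simp: sets_measure_of sa_of_def space_measure_of_conv)
  have "(\<lambda>x. if U k x < q k (V (Suc k) x) then V (Suc k) x - 1 else V (Suc k) x)
      \<in> sigma (space M) ?S \<rightarrow>\<^sub>M count_space UNIV"
    by measurable
  then have "V k \<in> sigma (space M) ?S \<rightarrow>\<^sub>M count_space UNIV"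
    by (subst measurable_cong[OF V_step]) (simp_all add: space_measure_of_conv pascal_step_def)
  then have "V k \<in> sigma (space M) (sigma_sets (space M) ?S) \<rightarrow>\<^sub>M count_space UNIV"
    by (simp only: measurable_cong_sets[OF sets_eq refl])
  then have "sa_of (space M) (V k) (count_space UNIV) \<subseteq> sigma_sets (space M) ?S"
    by (rule measurable_sigma_imp_sa_of_subset[OF sa])
  then show ?thesis
    unfolding nat_filt_def[of M V k] using sub
    by (intro sa_fam_subset[OF sa]) (metis atLeast_iff le_SucE not_less_eq_eq le_antisym)
qed

abbreviation "N \<equiv> completion M"
abbreviation "cF k \<equiv> sigma (space M) (aug_null M (F k))"

lemma prob_space_N: "prob_space N"
  by (rule prob_space_completion)

lemma sets_cF: "sets (cF k) = aug_null M (F k)" and space_cF: "space (cF k) = space M"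
  by (auto simp: space_measure_of_conv sigma_algebra.sets_measure_of_eq[OF aug_null_sigma_algebra[OF F_sigma_algebra]])

lemma cF_subalgebra: "finite_measure_subalgebra N (cF k)"
proof -
  interpret N: prob_space N by (rule prob_space_N)
  show ?thesis
  proof
    show "subalgebra N (cF k)"
      unfolding subalgebra_def sets_cF space_cF
      using aug_null_completionE[OF _ F_events[of k]] by auto
  qed
qed

lemma cF_sub: "sets (cF (Suc k)) \<subseteq> sets (cF k)"
  unfolding sets_cF by (intro aug_null_mono F_antimono) simp

lemma borel_measurable_cF_Suc: "f \<in> borel_measurable (cF (Suc k)) \<Longrightarrow> f \<in> borel_measurable (cF k)"
  by (rule measurable_from_subalg[of _ "cF (Suc k)"]) (auto simp: subalgebra_def cF_sub space_cF simp del: sets_measure_of)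

lemma measure_N_Int_innovation:
  assumes "A \<in> aug_null M (H (Suc k))" "B \<in> sets borel"
  shows "measure N ({x \<in> space M. U k x \<in> B} \<inter> A) = prob {x \<in> space M. U k x \<in> B} * measure N A"
proof -
  let ?D = "{x \<in> space M. U k x \<in> B}"
  obtain a where a: "a \<in> H (Suc k)" "AE x in N. x \<in> A \<longleftrightarrow> x \<in> a" "A \<in> sets N"
    using aug_null_completionE[OF assms(1) H_events] by blast
  have ae: "a \<in> events" using a(1) H_events by blast
  have D: "?D \<in> events" using assms(2) by (rule U_event)
  have "measure N (?D \<inter> A) = measure N (?D \<inter> a)"
    using a(2) by (intro measure_eq_AE) (use a(3) ae D in auto)
  also have "\<dots> = prob (?D \<inter> a)" using ae D by simp
  also have "\<dots> = prob ?D * prob a" by (rule prob_innovation[OF assms(2) a(1)])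
  also have "prob a = measure N a" using ae by simp
  also have "measure N a = measure N A"
    using a(2) by (intro measure_eq_AE) (use a(3) ae in auto)
  finally show ?thesis .
qed

lemma cond_exp_innovation:
  fixes k :: nat and B :: "real set"
  assumes "B \<in> sets borel"
  defines "D \<equiv> {x \<in> space M. U k x \<in> B}"
  shows "AE x in N. real_cond_exp N (cF (Suc k)) (indicator D) x = prob D"
proof -
  interpret N: prob_space N by (rule prob_space_N)
  interpret finite_measure_subalgebra N "cF (Suc k)" by (rule cF_subalgebra)
  have D: "D \<in> sets N" unfolding D_def using U_event[OF assms(1)] by simp
  show ?thesis
  proof (rule real_cond_exp_charact)
    fix C assume "C \<in> sets (cF (Suc k))"
    then have C: "C \<in> aug_null M (F (Suc k))" by (simp only: sets_cF)
    then have CH: "C \<in> aug_null M (H (Suc k))" using aug_null_mono[OF F_subset_H] by blast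
    have CN: "C \<in> sets N" using aug_null_completionE[OF C F_events] by blast
    have "(LINT x:C|N. indicator D x) = (LINT x|N. indicator (D \<inter> C) x)"
      unfolding set_lebesgue_integral_def
      by (intro Bochner_Integration.integral_cong) (auto simp: indicator_def)
    also have "\<dots> = measure N (D \<inter> C)"
      using sets.sets_into_space[OF sets.Int[OF D CN]] by (simp add: Int_absorb2)
    also have "\<dots> = prob D * measure N C"
      unfolding D_def by (rule measure_N_Int_innovation[OF CH assms(1)])
    also have "\<dots> = (LINT x:C|N. prob D)"
      using sets.sets_into_space[OF CN] by (simp add: set_lebesgue_integral_def Int_absorb2)
    finally show "(LINT x:C|N. indicator D x) = (LINT x:C|N. prob D)" .
  qed (use D in \<open>auto simp: integrable_indicator_iff N.emeasure_eq_measure\<close>)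
qed

text \<open>\<open>U k\<close> is independent of \<open>A\<close> and \<open>F (Suc k)\<close>
  jointly, so adjoining it to \<open>F (Suc k)\<close> does not change the conditional probability
  of \<open>A\<close>. The identity is checked on intersections of a past event with an event of
  \<open>U k\<close> and extended by Dynkin's argument.\<close>

lemma cond_exp_past_sigma_F_innovation:
  fixes k :: nat and A :: "'a set"
  assumes A: "A \<in> aug_null M (G (Suc k))"
    and C: "C \<in> sigma_sets (space M) (F (Suc k) \<union> sa_of (space M) (U k) borel)"
  defines "Z \<equiv> real_cond_exp N (cF (Suc k)) (indicator A)"
  shows "(LINT x:C|N. Z x) = measure N (A \<inter> C)"
proof -
  interpret N: prob_space N by (rule prob_space_N)
  interpret finite_measure_subalgebra N "cF (Suc k)" by (rule cF_subalgebra)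
  have AN: "A \<in> sets N" using aug_null_completionE[OF A G_events] by blast
  have iA: "integrable N (indicator A :: 'a \<Rightarrow> real)"
    using AN by (intro integrable_real_indicator) (simp_all add: N.emeasure_eq_measure)
  have Zint: "integrable N Z" unfolding Z_def by (rule real_cond_exp_int(1)[OF iA])
  have ZF[measurable]: "Z \<in> borel_measurable (cF (Suc k))" unfolding Z_def by simp
  define P where "P = {C1 \<inter> {x \<in> space M. U k x \<in> B} | C1 B. C1 \<in> F (Suc k) \<and> B \<in> sets borel}"
  have PI: "C1 \<inter> {x \<in> space M. U k x \<in> B} \<in> P" if "C1 \<in> F (Suc k)" "B \<in> sets borel" for C1 B
    unfolding P_def using that by blast
  interpret FS: sigma_algebra "space M" "F (Suc k)" by (rule F_sigma_algebra)
  have basic: "(LINT x:C|N. Z x) = measure N (A \<inter> C)" if CP: "C \<in> P" for C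
  proof -
    obtain C1 B where C: "C = C1 \<inter> {x \<in> space M. U k x \<in> B}" and C1: "C1 \<in> F (Suc k)" and B: "B \<in> sets borel"
      using CP unfolding P_def by blast
    define D where "D = {x \<in> space M. U k x \<in> B}"
    have DM: "D \<in> events" unfolding D_def using B by (rule U_event)
    have C1M: "C1 \<in> events" using C1 F_events by blast
    have C1F: "C1 \<in> sets (cF (Suc k))" unfolding sets_cF using C1 subset_aug_null by blast
    have [measurable]: "(indicator C1 :: 'a \<Rightarrow> real) \<in> borel_measurable (cF (Suc k))"
      using C1F by (rule borel_measurable_indicator)
    \<comment> \<open>\<open>A\<close> belongs to the past of the innovations and \<open>C1\<close>
      to that of the vertices; their intersection is covered only by independence from the joint
      past.\<close>
    have AC1: "A \<inter> C1 \<in> aug_null M (H (Suc k))"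
    proof -
      interpret sigma_algebra "space M" "aug_null M (H (Suc k))"
        by (rule aug_null_sigma_algebra[OF H_sigma_algebra])
      have "A \<in> aug_null M (H (Suc k))" using A aug_null_mono[OF G_subset_H] by blast
      moreover have "C1 \<in> aug_null M (H (Suc k))" using C1 F_subset_H subset_aug_null by blast
      ultimately show ?thesis by (rule Int)
    qed
    have "(LINT x:C|N. Z x) = (LINT x|N. (indicator C1 x * Z x) * indicator D x)"
      unfolding set_lebesgue_integral_def C D_def
      by (intro Bochner_Integration.integral_cong) (auto simp: indicator_def)
    \<comment> \<open>The factor before \<open>indicator D x\<close> is measurable for
      \<open>cF (Suc k)\<close>, so the indicator may be replaced by its conditional expectation,
      which is the constant \<open>prob D\<close>.\<close>
    also have "\<dots> = (LINT x|N. (indicator C1 x * Z x) * real_cond_exp N (cF (Suc k)) (indicator D) x)"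
    proof (rule real_cond_exp_intg(2)[symmetric])
      have "integrable N (\<lambda>x. indicator (C1 \<inter> D) x *\<^sub>R Z x)"
        using Zint C1M DM by (intro integrable_mult_indicator) auto
      then show "integrable N (\<lambda>x. indicator C1 x * Z x * indicator D x)"
        by (simp add: indicator_inter_arith mult_ac)
      show "indicat_real D \<in> borel_measurable N"
        by (rule borel_measurable_indicator[OF sets_completionI_sets[OF DM]])
    qed simp
    also have "\<dots> = (LINT x|N. prob D * (indicator C1 x * Z x))"
    proof (rule integral_cong_AE)
      show "AE x in N. (indicator C1 x * Z x) * real_cond_exp N (cF (Suc k)) (indicator D) x = prob D * (indicator C1 x * Z x)"
        using cond_exp_innovation[OF B, of k] unfolding D_def[symmetric] by eventually_elim simp
    qed (auto simp: Z_def intro!: borel_measurable_times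
        borel_measurable_indicator[OF sets_completionI_sets[OF C1M]])
    also have "\<dots> = prob D * (LINT x:C1|N. Z x)"
      by (simp add: set_lebesgue_integral_def)
    also have "(LINT x:C1|N. Z x) = (LINT x:C1|N. indicator A x)"
      unfolding Z_def by (rule real_cond_exp_intA[OF iA C1F, symmetric])
    also have "\<dots> = measure N (A \<inter> C1)"
      using sets.sets_into_space[OF AN] by (subst set_lebesgue_integral_def)
        (simp add: indicator_inter_arith[symmetric] Int_commute Int_absorb1 le_infI1)
    also have "prob D * \<dots> = measure N (D \<inter> (A \<inter> C1))"
      unfolding D_def by (rule measure_N_Int_innovation[OF AC1 B, symmetric])
    also have "D \<inter> (A \<inter> C1) = A \<inter> C" unfolding C D_def by auto
    finally show ?thesis .
  qed
  have PM: "P \<subseteq> events"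
    unfolding P_def using F_events[of "Suc k"] by (auto intro!: sets.Int U_event)
  have PP: "P \<subseteq> Pow (space M)" using PM sets.sets_into_space by blast
  have stable: "Int_stable P"
  proof (rule Int_stableI)
    fix a b assume "a \<in> P" "b \<in> P"
    then obtain C1 B C2 B' where *: "a = C1 \<inter> {x \<in> space M. U k x \<in> B}" "b = C2 \<inter> {x \<in> space M. U k x \<in> B'}"
      "C1 \<in> F (Suc k)" "C2 \<in> F (Suc k)" "B \<in> sets borel" "B' \<in> sets borel"
      unfolding P_def by blast
    have "a \<inter> b = (C1 \<inter> C2) \<inter> {x \<in> space M. U k x \<in> B \<inter> B'}" unfolding * by auto
    then show "a \<inter> b \<in> P" using PI[OF FS.Int[OF *(3,4)] sets.Int[OF *(5,6)]] by simp
  qed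
  have "F (Suc k) \<union> sa_of (space M) (U k) borel \<subseteq> P"
  proof (intro Un_least subsetI)
    fix c assume c: "c \<in> F (Suc k)"
    then have "c = c \<inter> {x \<in> space M. U k x \<in> UNIV}" using FS.sets_into_space by auto
    then show "c \<in> P" using PI[OF c, of UNIV] by simp
  next
    fix c assume "c \<in> sa_of (space M) (U k) borel"
    then obtain B where "B \<in> sets borel" "c = U k -` B \<inter> space M"
      unfolding sa_of_def by auto
    moreover from this have "c = space M \<inter> {x \<in> space M. U k x \<in> B}" by auto
    ultimately show "c \<in> P" using PI[OF FS.top, of B] by simp
  qed
  then have CP: "C \<in> sigma_sets (space M) P" using C sigma_sets_mono'[of _ P] by blast
  have sigM: "sigma_sets (space M) P \<subseteq> sets N" using sets.sigma_sets_subset[OF PM] by auto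
  have spP: "space M \<in> P" using PI[OF FS.top, of UNIV] by simp
  have setint: "set_integrable N c Z" if "c \<in> sets N" for c
    unfolding set_integrable_def using Zint that by (intro integrable_mult_indicator)
  from stable PP CP show ?thesis
  proof (induction rule: sigma_sets_induct_disjoint)
    case (basic c) then show ?case by (rule \<open>\<And>C. C \<in> P \<Longrightarrow> (LINT x:C|N. Z x) = measure N (A \<inter> C)\<close>)
  next
    case empty show ?case by (simp add: set_lebesgue_integral_def)
  next
    case (compl c)
    have c: "c \<in> sets N" "c \<subseteq> space M" using compl.hyps sigM sigma_sets_into_sp[OF PP] by blast+
    have "(LINT x:space M - c|N. Z x) = (LINT x:space M|N. Z x) - (LINT x:c|N. Z x)"
      using set_integral_Un[of c "space M - c" N Z] setint[OF c(1)] setint[OF sets.compl_sets[OF c(1)]] c(2)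
      by (simp add: Un_absorb1)
    also have "\<dots> = measure N (A \<inter> space M) - measure N (A \<inter> c)"
      using basic[OF spP] compl.IH by simp
    also have "\<dots> = measure N (A \<inter> space M - A \<inter> c)"
      using c AN by (intro N.finite_measure_Diff[symmetric]) auto
    also have "A \<inter> space M - A \<inter> c = A \<inter> (space M - c)" by auto
    finally show ?case .
  next
    case (union c)
    have c: "range c \<subseteq> sets N" using union.hyps(2) sigM by blast
    have "(LINT x:(\<Union>i. c i)|N. Z x) = (\<Sum>i. (LINT x:c i|N. Z x))"
      using union.hyps(1) c
      by (intro lebesgue_integral_countable_add setint) (auto simp: disjoint_family_on_def)
    also have "\<dots> = (\<Sum>i. measure N (A \<inter> c i))" using union.IH by simp
    also have "\<dots> = measure N (\<Union>i. A \<inter> c i)"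
    proof -
      have "range (\<lambda>i. A \<inter> c i) \<subseteq> sets N" using c AN by (simp add: image_subset_iff)
      moreover have "disjoint_family (\<lambda>i. A \<inter> c i)" using union.hyps(1) unfolding disjoint_family_on_def by blast
      ultimately show ?thesis by (rule N.finite_measure_UNION[THEN sums_unique, symmetric])
    qed
    finally show ?case by (simp only: Int_UN_distrib)
  qed
qed

text \<open>The form of immersion used here: given \<open>F (Suc k)\<close>, the newer vertex
  carries no information about past innovations. It follows since \<open>F k\<close> lies between
  \<open>F (Suc k)\<close> and the algebra obtained by adjoining \<open>U k\<close>.\<close>

lemma cond_exp_past_F_eq:
  fixes k :: nat and A :: "'a set"
  assumes A: "A \<in> aug_null M (G (Suc k))"
  shows "AE x in N. real_cond_exp N (cF k) (indicator A) x = real_cond_exp N (cF (Suc k)) (indicator A) x"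
proof -
  interpret N: prob_space N by (rule prob_space_N)
  interpret S: finite_measure_subalgebra N "cF (Suc k)" by (rule cF_subalgebra)
  interpret finite_measure_subalgebra N "cF k" by (rule cF_subalgebra)
  have AN: "A \<in> sets N" using aug_null_completionE[OF A G_events] by blast
  have iA: "integrable N (indicator A :: 'a \<Rightarrow> real)"
    using AN by (intro integrable_real_indicator) (simp_all add: N.emeasure_eq_measure)
  let ?Z = "real_cond_exp N (cF (Suc k)) (indicator A)"
  show ?thesis
  proof (rule real_cond_exp_charact[OF _ iA S.real_cond_exp_int(1)[OF iA]])
    show "?Z \<in> borel_measurable (cF k)" by (rule borel_measurable_cF_Suc) simp
    fix C assume "C \<in> sets (cF k)"
    then have "C \<in> aug_null M (F k)" by (simp only: sets_cF)
    then obtain c where c: "c \<in> F k" "AE x in N. x \<in> C \<longleftrightarrow> x \<in> c" "C \<in> sets N"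
      using aug_null_completionE[OF _ F_events] by blast
    have cN: "c \<in> sets N" using c(1) F_events by auto
    have "(LINT x:C|N. indicator A x) = (LINT x|N. indicator (A \<inter> C) x)"
      unfolding set_lebesgue_integral_def
      by (intro Bochner_Integration.integral_cong) (auto simp: indicator_def)
    also have "\<dots> = measure N (A \<inter> C)"
      using sets.sets_into_space[OF sets.Int[OF AN c(3)]] by (simp add: Int_absorb2)
    also have "\<dots> = measure N (A \<inter> c)"
      using c(2) by (intro measure_eq_AE) (use c(3) cN AN in auto)
    also have "\<dots> = (LINT x:c|N. ?Z x)"
      using c(1) F_subset_sigma_F_innovation[of k] by (intro cond_exp_past_sigma_F_innovation[OF A, symmetric]) blast
    also have "\<dots> = (LINT x:C|N. ?Z x)"
      unfolding set_lebesgue_integral_def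
    proof (rule integral_cong_AE)
      show "AE x in N. indicat_real c x *\<^sub>R ?Z x = indicat_real C x *\<^sub>R ?Z x"
        using c(2) by eventually_elim (simp add: indicator_def)
    qed (use c(3) cN in auto)
    finally show "(LINT x:C|N. indicator A x) = (LINT x:C|N. ?Z x)" .
  qed
qed

text \<open>For \<open>A\<close> in the augmented \<open>G (Suc k)\<close> the indicator is moved
  onto its conditional expectation given \<open>F k\<close>, which is also the one given
  \<open>F (Suc k)\<close>. There the martingale property replaces \<open>X k\<close> by
  \<open>X (Suc k)\<close>, and the indicator is restored.\<close>

lemma immersed_F_G: "immersed N (\<lambda>k. aug_null M (F k)) (\<lambda>k. aug_null M (G k))"
proof -
  interpret N: prob_space N by (rule prob_space_N)
  have sub: "aug_null M (F k) \<subseteq> aug_null M (G k)" for k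
    using aug_null_mono[OF F_subset_aug_null_G[of k]] aug_null_idem by blast
  have GP: "aug_null M (G k) \<subseteq> Pow (space M)" for k
    by (rule aug_null_subset_Pow[OF sa_fam_subset_Pow])
  have sets_cG: "sets (sigma (space M) (aug_null M (G k))) = aug_null M (G k)" for k
    by (rule sigma_algebra.sets_measure_of_eq[OF aug_null_sigma_algebra[OF G_sigma_algebra]])
  have FG: "f \<in> borel_measurable (sigma (space M) (aug_null M (G k)))" if "f \<in> borel_measurable (cF k)"
    for f :: "'a \<Rightarrow> real" and k
    using measurable_mono1[OF GP sub] that by blast
  have mart: "AE x in N. real_cond_exp N (sigma (space M) (aug_null M (G (Suc k)))) (X k) x = X (Suc k) x"
    if X: "\<And>k. integrable N (X k)" "\<And>k. X k \<in> borel_measurable (cF k)"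
      "\<And>k. AE x in N. real_cond_exp N (cF (Suc k)) (X k) x = X (Suc k) x" for X k
  proof -
    interpret S: finite_measure_subalgebra N "cF (Suc k)" by (rule cF_subalgebra)
    interpret K: finite_measure_subalgebra N "cF k" by (rule cF_subalgebra)
    interpret G: finite_measure_subalgebra N "sigma (space M) (aug_null M (G (Suc k)))"
    proof
      show "subalgebra N (sigma (space M) (aug_null M (G (Suc k))))"
        unfolding subalgebra_def sets_cG
        using aug_null_completionE[OF _ G_events[of "Suc k"]] by (auto simp: space_measure_of_conv)
    qed
    show ?thesis
    proof (rule G.real_cond_exp_charact[OF _ X(1) X(1) FG[OF X(2)]])
      fix A assume "A \<in> sets (sigma (space M) (aug_null M (G (Suc k))))"
      then have A: "A \<in> aug_null M (G (Suc k))" by (simp only: sets_cG)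
      have AN: "A \<in> sets N" using aug_null_completionE[OF A G_events] by blast
      let ?Z = "real_cond_exp N (cF (Suc k)) (indicator A)"
      have iA: "(indicator A :: 'a \<Rightarrow> real) \<in> borel_measurable N" using AN by simp
      have int: "integrable N (\<lambda>x. X j x * indicator A x)" for j
        using integrable_mult_indicator[OF AN X(1)[of j]] by (simp add: mult.commute)
      have [measurable]: "X j \<in> borel_measurable N" for j using X(1) by blast
      have aeZ: "AE x in N. X k x * real_cond_exp N (cF k) (indicator A) x = ?Z x * X k x"
        using cond_exp_past_F_eq[OF A] by eventually_elim simp
      have intZ: "integrable N (\<lambda>x. ?Z x * X k x)"
        using K.real_cond_exp_intg(1)[OF int X(2) iA] aeZ
        by (subst integrable_cong_AE[symmetric, where f="\<lambda>x. X k x * real_cond_exp N (cF k) (indicator A) x"]) auto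
      have "(LINT x:A|N. X k x) = (LINT x|N. X k x * indicator A x)"
        by (simp add: set_lebesgue_integral_def mult.commute)
      also have "\<dots> = (LINT x|N. X k x * real_cond_exp N (cF k) (indicator A) x)"
        by (rule K.real_cond_exp_intg(2)[OF int X(2) iA, symmetric])
      also have "\<dots> = (LINT x|N. ?Z x * X k x)"
        by (rule integral_cong_AE[OF _ _ aeZ]) auto
      also have "\<dots> = (LINT x|N. ?Z x * real_cond_exp N (cF (Suc k)) (X k) x)"
        by (rule S.real_cond_exp_intg(2)[OF intZ, symmetric]) auto
      also have "\<dots> = (LINT x|N. X (Suc k) x * ?Z x)"
      proof (rule integral_cong_AE)
        show "AE x in N. ?Z x * real_cond_exp N (cF (Suc k)) (X k) x = X (Suc k) x * ?Z x"
          using X(3)[of k] by eventually_elim simp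
      qed auto
      also have "\<dots> = (LINT x|N. X (Suc k) x * indicator A x)"
        by (rule S.real_cond_exp_intg(2)[OF int X(2) iA])
      also have "\<dots> = (LINT x:A|N. X (Suc k) x)"
        by (simp add: set_lebesgue_integral_def mult.commute)
      finally show "(LINT x:A|N. X k x) = (LINT x:A|N. X (Suc k) x)" .
    qed
  qed
  show ?thesis
    unfolding immersed_def martingale_wrt_def space_completion
    using sub FG mart by blast
qed

end

section \<open>Extraction of uniform innovations\<close>

text \<open>The distribution function of the uniform law on the unit interval.\<close>

definition clip01 :: "real \<Rightarrow> real" where
  "clip01 a = max 0 (min 1 a)"

text \<open>The uniform law is the mixture, with weights \<open>p\<close> and \<open>1 - p\<close>,
  of the uniform laws below and above \<open>p\<close>. For \<open>p = 0\<close> or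
  \<open>p = 1\<close> the quotient with zero denominator has weight zero.\<close>

lemma clip01_split:
  assumes "0 \<le> p" "p \<le> 1"
  shows "p * clip01 (a / p) + (1 - p) * clip01 ((a - p) / (1 - p)) = clip01 a"
proof -
  consider "p = 0" | "p = 1" | "0 < p" "p < 1" using assms by linarith
  then show ?thesis
  proof cases
    case 3
    have "p * clip01 (a / p) = max 0 (min p a)"
      using 3 by (auto simp: clip01_def max_def min_def field_simps)
    moreover have "(1 - p) * clip01 ((a - p) / (1 - p)) = max 0 (min (1 - p) (a - p))"
      using 3 by (auto simp: clip01_def max_def min_def field_simps)
    ultimately show ?thesis using 3 by (auto simp: clip01_def max_def min_def)
  qed (auto simp: clip01_def)
qed

lemma borel_measurable_split_uniform:
  fixes f g :: "'a \<Rightarrow> nat" and p t :: "'a \<Rightarrow> real"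
  assumes [measurable]: "f \<in> S \<rightarrow>\<^sub>M count_space UNIV" "g \<in> S \<rightarrow>\<^sub>M count_space UNIV"
    "p \<in> borel_measurable S" "t \<in> borel_measurable S"
  shows "(\<lambda>x. if f x = g x then p x + (1 - p x) * t x else if p x = 0 then -1 else p x * t x) \<in> borel_measurable S"
proof -
  have "{x \<in> space S. f x = g x} = (\<Union>n. (f -` {n} \<inter> space S) \<inter> (g -` {n} \<inter> space S))" by auto
  also have "\<dots> \<in> sets S"
    by (intro sets.countable_UN' sets.Int measurable_sets[OF assms(1)] measurable_sets[OF assms(2)]) auto
  finally have [measurable]: "Measurable.pred S (\<lambda>x. f x = g x)" by (simp add: pred_def)
  have [measurable]: "Measurable.pred S (\<lambda>x. p x = 0)"
    using measurable_sets[OF assms(3), of "{0}"] by (simp add: pred_def vimage_def Int_def conj_commute)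
  show ?thesis by (intro measurable_If) simp_all
qed

text \<open>In \<open>r_uniform_indep\<close> the event \<open>A\<close> ranges over the whole path,
  not only its past: \<open>U k\<close> is built from \<open>r k\<close> and the transition between
  \<open>V (Suc k)\<close> and \<open>V k\<close>.\<close>

locale pascal_randomized = vertex_process M V for M :: "'a measure" and V +
  fixes r :: "nat \<Rightarrow> 'a \<Rightarrow> real"
  assumes r_measurable[measurable]: "r k \<in> borel_measurable M"
    and V_0: "x \<in> space M \<Longrightarrow> V 0 x = 0"
    and V_Suc: "x \<in> space M \<Longrightarrow> V (Suc k) x = V k x \<or> V (Suc k) x = Suc (V k x)"
    and r_range: "x \<in> space M \<Longrightarrow> 0 \<le> r k x \<and> r k x < 1"
    and markov: "A \<in> nat_filt M V (Suc k) \<Longrightarrow>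
      prob ({x \<in> space M. V k x = v \<and> V (Suc k) x = w} \<inter> A) * prob {x \<in> space M. V (Suc k) x = w} =
      prob {x \<in> space M. V k x = v \<and> V (Suc k) x = w} * prob ({x \<in> space M. V (Suc k) x = w} \<inter> A)"
    and r_uniform_indep: "A \<in> nat_filt M V 0 \<Longrightarrow> B \<in> sa_fam (space M) r borel {Suc k..} \<Longrightarrow>
      prob (A \<inter> {x \<in> space M. r k x \<le> a} \<inter> B) = prob A * clip01 a * prob B"
begin

text \<open>The conditional probability of a drop given \<open>V (Suc k) = w\<close>. Writing
  \<open>V k x \<noteq> w\<close> instead of \<open>V k x = w - 1\<close> makes it 0 at
  \<open>w = 0\<close>; at vertices of probability zero the quotient is 0 as well.\<close>

definition q :: "nat \<Rightarrow> nat \<Rightarrow> real" where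
  "q k w = prob {x \<in> space M. V k x \<noteq> w \<and> V (Suc k) x = w} / prob {x \<in> space M. V (Suc k) x = w}"

text \<open>Given \<open>V (Suc k) = w\<close>, this places \<open>U k\<close> uniformly in \<open>[0, q k w)\<close> or \<open>[q k w, 1)\<close> according to
  the observed transition.  The value \<open>-1\<close> occurs on a null event only; it makes the recursion
  for \<open>V k\<close> hold everywhere.\<close>

definition U :: "nat \<Rightarrow> 'a \<Rightarrow> real" where
  "U k x = (let p = q k (V (Suc k) x) in
     if V k x = V (Suc k) x then p + (1 - p) * r k x else if p = 0 then -1 else p * r k x)"

lemma q_nonneg: "0 \<le> q k w" and q_le_1: "q k w \<le> 1"
proof -
  show "0 \<le> q k w" by (simp add: q_def)
  have "prob {x \<in> space M. V k x \<noteq> w \<and> V (Suc k) x = w} \<le> prob {x \<in> space M. V (Suc k) x = w}"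
    by (intro finite_measure_mono) auto
  then show "q k w \<le> 1" by (simp add: q_def divide_le_eq_1 zero_less_measure_iff)
qed

lemma U_measurable_if:
  assumes "V k \<in> S \<rightarrow>\<^sub>M count_space UNIV" "V (Suc k) \<in> S \<rightarrow>\<^sub>M count_space UNIV"
    "r k \<in> borel_measurable S"
  shows "U k \<in> borel_measurable S"
  unfolding U_def Let_def using assms
  by (intro borel_measurable_split_uniform measurable_compose[OF assms(2)]) simp_all

lemma U_measurable[measurable]: "U k \<in> borel_measurable M"
  by (rule U_measurable_if) measurable

lemma V_le: "x \<in> space M \<Longrightarrow> V k x \<le> k"
proof (induction k)
  case (Suc k) then show ?case using V_Suc[of x k] by auto
qed (simp add: V_0)

lemma V_eq_pascal_step: 
  assumes "x \<in> space M"
  shows "V k x = pascal_step (q k) (V (Suc k) x) (U k x)"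
proof (cases "V k x = V (Suc k) x")
  case True
  have "0 \<le> (1 - q k (V (Suc k) x)) * r k x"
    using r_range[OF assms, of k] q_le_1[of k "V (Suc k) x"] by (intro mult_nonneg_nonneg) auto
  then have "\<not> U k x < q k (V (Suc k) x)" using True by (simp add: U_def Let_def)
  then show ?thesis using True by (simp add: pascal_step_def)
next
  case False
  then have "V (Suc k) x = Suc (V k x)" using V_Suc[OF assms, of k] by auto
  \<comment> \<open>Strictness comes from \<open>r k x < 1\<close>; for threshold 0 the value
    \<open>-1\<close> stays below it.\<close>
  moreover have "q k (V (Suc k) x) \<noteq> 0 \<Longrightarrow> q k (V (Suc k) x) * r k x < q k (V (Suc k) x)"
    using r_range[OF assms, of k] q_nonneg[of k "V (Suc k) x"] by (simp add: less_le)
  ultimately show ?thesis using False by (auto simp: pascal_step_def U_def Let_def)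
qed

abbreviation "R k \<equiv> sa_fam (space M) r borel {k..}"

lemma R_events: "R k \<subseteq> events"
  by (intro sa_fam_subset_sets) auto

lemma R_sigma_algebra: "sigma_algebra (space M) (R k)"
  by (rule sa_fam_sigma_algebra)

lemma prob_drop_Int:
  assumes A: "A \<in> F (Suc k)"
  shows "prob ({x \<in> space M. V k x \<noteq> w \<and> V (Suc k) x = w} \<inter> A) = q k w * prob ({x \<in> space M. V (Suc k) x = w} \<inter> A)"
proof (cases w)
  case 0
  then have eq: "{x \<in> space M. V k x \<noteq> w \<and> V (Suc k) x = w} = {}" using V_Suc[of _ k] by fastforce
  show ?thesis unfolding q_def eq by simp
next
  case (Suc v)
  have [measurable]: "A \<in> events" using A F_events by blast
  have eq: "{x \<in> space M. V k x \<noteq> w \<and> V (Suc k) x = w} = {x \<in> space M. V k x = v \<and> V (Suc k) x = w}"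
    using V_Suc[of _ k] Suc by fastforce
  show ?thesis
  proof (cases "prob {x \<in> space M. V (Suc k) x = w} = 0")
    case True
    have "prob ({x \<in> space M. V k x \<noteq> w \<and> V (Suc k) x = w} \<inter> A) \<le> prob {x \<in> space M. V (Suc k) x = w}"
      by (intro finite_measure_mono) auto
    then show ?thesis using True by (simp add: q_def measure_le_0_iff)
  next
    case False
    then show ?thesis using markov[OF A, of v w] unfolding q_def eq by (simp add: field_simps)
  qed
qed

lemma prob_stay_Int:
  assumes A: "A \<in> F (Suc k)"
  shows "prob ({x \<in> space M. V k x = w \<and> V (Suc k) x = w} \<inter> A) = (1 - q k w) * prob ({x \<in> space M. V (Suc k) x = w} \<inter> A)"
proof -
  have [measurable]: "A \<in> events" using A F_events by blast
  let ?D = "{x \<in> space M. V k x \<noteq> w \<and> V (Suc k) x = w} \<inter> A"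
    and ?S = "{x \<in> space M. V k x = w \<and> V (Suc k) x = w} \<inter> A"
  have "prob ({x \<in> space M. V (Suc k) x = w} \<inter> A) = prob (?D \<union> ?S)"
    by (rule arg_cong[where f=prob]) auto
  also have "\<dots> = prob ?D + prob ?S"
    by (intro finite_measure_Union) auto
  finally show ?thesis unfolding prob_drop_Int[OF A] by (simp add: algebra_simps)
qed

text \<open>At a fixed vertex, \<open>U k\<close> is uniform below \<open>p\<close> after a drop and
  uniform above \<open>p\<close> after a stay, and these occur with conditional probabilities
  \<open>p\<close> and \<open>1 - p\<close>. The mixture no longer depends on \<open>w\<close>,
  whence the independence from the past. If \<open>p\<close> is 0 or 1, the branch with the zero
  denominator is a null event.\<close>

lemma prob_U_le_fibre:
  assumes A: "A \<in> F (Suc k)" and B: "B \<in> R (Suc k)"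
  shows "prob ({x \<in> space M. U k x \<le> a} \<inter> ({x \<in> space M. V (Suc k) x = w} \<inter> A) \<inter> B) =
    clip01 a * prob ({x \<in> space M. V (Suc k) x = w} \<inter> A) * prob B"
proof -
  define p where "p = q k w"
  define W where "W = prob ({x \<in> space M. V (Suc k) x = w} \<inter> A)"
  define D where "D = {x \<in> space M. V k x \<noteq> w \<and> V (Suc k) x = w} \<inter> A"
  define S where "S = {x \<in> space M. V k x = w \<and> V (Suc k) x = w} \<inter> A"
  interpret F0: sigma_algebra "space M" "F 0" by (rule F_sigma_algebra)
  have F0I: "{x \<in> space M. P (V j x)} \<in> F 0" for P j
    using V_in_F F_antimono[of 0 j] by auto
  have "A \<in> F 0" using A F_antimono[of 0 "Suc k"] by auto
  moreover have "D = {x \<in> space M. V k x \<noteq> w} \<inter> {x \<in> space M. V (Suc k) x = w} \<inter> A"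
    "S = {x \<in> space M. V k x = w} \<inter> {x \<in> space M. V (Suc k) x = w} \<inter> A" by (auto simp: D_def S_def)
  ultimately have D0: "D \<in> F 0" and S0: "S \<in> F 0"
    using F0I[of "\<lambda>y. y \<noteq> w" k] F0I[of "\<lambda>y. y = w" k] F0I[of "\<lambda>y. y = w" "Suc k"] by (auto intro!: F0.Int)
  have [measurable]: "A \<in> events" "B \<in> events" "D \<in> events" "S \<in> events"
    using A B D0 S0 F_events R_events by blast+
  have pD: "prob D = p * W" and pS: "prob S = (1 - p) * W"
    unfolding D_def S_def p_def W_def by (rule prob_drop_Int[OF A], rule prob_stay_Int[OF A])
  have Dpart: "prob ({x \<in> space M. U k x \<le> a} \<inter> D \<inter> B) = p * clip01 (a / p) * W * prob B"
  proof (cases "p = 0")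
    case True
    have "prob ({x \<in> space M. U k x \<le> a} \<inter> D \<inter> B) \<le> prob D" by (intro finite_measure_mono) auto
    then show ?thesis using pD True by (simp add: measure_le_0_iff)
  next
    case False
    then have p: "p > 0" using q_nonneg[of k w] by (simp add: p_def)
    have "{x \<in> space M. U k x \<le> a} \<inter> D \<inter> B = D \<inter> {x \<in> space M. r k x \<le> a / p} \<inter> B"
      using p by (auto simp: D_def U_def Let_def p_def field_simps)
    then show ?thesis using r_uniform_indep[OF D0 B, of "a / p"] pD by simp
  qed
  have Spart: "prob ({x \<in> space M. U k x \<le> a} \<inter> S \<inter> B) = (1 - p) * clip01 ((a - p) / (1 - p)) * W * prob B"
  proof (cases "p = 1")
    case True
    have "prob ({x \<in> space M. U k x \<le> a} \<inter> S \<inter> B) \<le> prob S" by (intro finite_measure_mono) auto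
    then show ?thesis using pS True by (simp add: measure_le_0_iff)
  next
    case False
    then have p: "p < 1" using q_le_1[of k w] by (simp add: p_def)
    have "U k x = p + (1 - p) * r k x" if "x \<in> S" for x
      using that by (auto simp: S_def U_def Let_def p_def)
    moreover have "p + (1 - p) * y \<le> a \<longleftrightarrow> y \<le> (a - p) / (1 - p)" for y
      using p by (simp add: pos_le_divide_eq algebra_simps)
    ultimately have "x \<in> S \<Longrightarrow> U k x \<le> a \<longleftrightarrow> r k x \<le> (a - p) / (1 - p)" for x by simp
    then have "{x \<in> space M. U k x \<le> a} \<inter> S \<inter> B = S \<inter> {x \<in> space M. r k x \<le> (a - p) / (1 - p)} \<inter> B"
      by blast
    then show ?thesis using r_uniform_indep[OF S0 B, of "(a - p) / (1 - p)"] pS by simp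
  qed
  have "prob ({x \<in> space M. U k x \<le> a} \<inter> ({x \<in> space M. V (Suc k) x = w} \<inter> A) \<inter> B) =
     prob (({x \<in> space M. U k x \<le> a} \<inter> D \<inter> B) \<union> ({x \<in> space M. U k x \<le> a} \<inter> S \<inter> B))"
    by (rule arg_cong[where f=prob]) (auto simp: D_def S_def)
  also have "\<dots> = prob ({x \<in> space M. U k x \<le> a} \<inter> D \<inter> B) + prob ({x \<in> space M. U k x \<le> a} \<inter> S \<inter> B)"
  proof (rule finite_measure_Union)
    show "{x \<in> space M. U k x \<le> a} \<inter> D \<inter> B \<inter> ({x \<in> space M. U k x \<le> a} \<inter> S \<inter> B) = {}"
      by (auto simp: D_def S_def)
  qed auto
  also have "\<dots> = (p * clip01 (a / p) + (1 - p) * clip01 ((a - p) / (1 - p))) * W * prob B"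
    unfolding Dpart Spart by (simp add: algebra_simps)
  also have "\<dots> = clip01 a * W * prob B"
    using clip01_split[of p a] q_nonneg[of k w] q_le_1[of k w] by (simp add: p_def)
  finally show ?thesis unfolding W_def .
qed

lemma prob_U_le:
  assumes A: "A \<in> F (Suc k)" and B: "B \<in> R (Suc k)"
  shows "prob ({x \<in> space M. U k x \<le> a} \<inter> A \<inter> B) = clip01 a * prob A * prob B"
proof -
  have [measurable]: "A \<in> events" "B \<in> events" using A B F_events R_events by blast+
  have Asp: "A \<subseteq> space M" by (simp add: sets.sets_into_space)
  let ?A = "\<lambda>w. {x \<in> space M. V (Suc k) x = w} \<inter> A"
  have "prob ({x \<in> space M. U k x \<le> a} \<inter> A \<inter> B) = prob (\<Union>w\<in>{..Suc k}. {x \<in> space M. U k x \<le> a} \<inter> ?A w \<inter> B)"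
    by (rule arg_cong[where f=prob]) (use V_le[of _ "Suc k"] in auto)
  also have "\<dots> = (\<Sum>w\<le>Suc k. prob ({x \<in> space M. U k x \<le> a} \<inter> ?A w \<inter> B))"
  proof (rule finite_measure_finite_Union)
    show "disjoint_family_on (\<lambda>w. {x \<in> space M. U k x \<le> a} \<inter> ?A w \<inter> B) {..Suc k}"
      by (auto simp: disjoint_family_on_def)
  qed auto
  also have "\<dots> = (\<Sum>w\<le>Suc k. clip01 a * prob (?A w) * prob B)"
    by (intro sum.cong refl prob_U_le_fibre A B)
  also have "\<dots> = clip01 a * (\<Sum>w\<le>Suc k. prob (?A w)) * prob B"
    by (simp only: sum_distrib_left sum_distrib_right)
  also have "(\<Sum>w\<le>Suc k. prob (?A w)) = prob (\<Union>w\<in>{..Suc k}. ?A w)"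
  proof (rule finite_measure_finite_Union[symmetric])
    show "disjoint_family_on ?A {..Suc k}" by (auto simp: disjoint_family_on_def)
  qed auto
  also have "(\<Union>w\<in>{..Suc k}. ?A w) = A" using V_le[of _ "Suc k"] Asp by auto
  finally show ?thesis .
qed

lemma prob_past_Int:
  assumes A: "A \<in> F (Suc k)" and B: "B \<in> R (Suc k)"
  shows "prob (A \<inter> B) = prob A * prob B"
proof -
  have "A \<in> events" using A F_events by blast
  then have "A \<inter> {x \<in> space M. r k x \<le> 1} \<inter> B = A \<inter> B"
    using r_range sets.sets_into_space[of A M] by (auto simp: less_imp_le)
  moreover have "A \<in> F 0" using A F_antimono[of 0 "Suc k"] by auto
  ultimately show ?thesis using r_uniform_indep[OF _ B, of A 1] by (simp add: clip01_def)
qed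

text \<open>It is enough to test half-lines of \<open>U k\<close> against intersections of a past
  path event with a past event of \<open>r\<close>: both families are stable under intersection, and
  together with \<open>V\<close> and \<open>r\<close> the second one captures every deeper
  innovation.\<close>

lemma indep_innovation: "indep_set (sa_of (space M) (U k) borel)
    (sigma_sets (space M) (F (Suc k) \<union> sa_fam (space M) U borel {Suc k..}))"
proof -
  define LE where "LE = {{x \<in> space M. U k x \<le> a} | a. True}"
  define PB where "PB = {A \<inter> B | A B. A \<in> F (Suc k) \<and> B \<in> R (Suc k)}"
  interpret F: sigma_algebra "space M" "F (Suc k)" by (rule F_sigma_algebra)
  interpret R: sigma_algebra "space M" "R (Suc k)" by (rule R_sigma_algebra)
  have PBI: "A \<inter> B \<in> PB" if "A \<in> F (Suc k)" "B \<in> R (Suc k)" for A B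
    unfolding PB_def using that by blast
  have PBE: "\<exists>A B. C = A \<inter> B \<and> A \<in> F (Suc k) \<and> B \<in> R (Suc k)" if "C \<in> PB" for C
    using that unfolding PB_def by blast
  have PBM: "PB \<subseteq> events"
  proof
    fix C assume "C \<in> PB"
    then obtain A B where "C = A \<inter> B" "A \<in> F (Suc k)" "B \<in> R (Suc k)" using PBE by blast
    then show "C \<in> events" using F_events R_events by (auto intro!: sets.Int)
  qed
  have LEM: "LE \<subseteq> events" unfolding LE_def by auto
  have U_law: "prob {x \<in> space M. U k x \<le> a} = clip01 a" for a
  proof -
    have "{x \<in> space M. U k x \<le> a} \<inter> space M \<inter> space M = {x \<in> space M. U k x \<le> a}" by auto
    then show ?thesis using prob_U_le[OF F.top R.top, of a] by (simp add: prob_space)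
  qed
  have "indep_set LE PB"
  proof (rule indep_setI[OF LEM PBM])
    fix a b assume a: "a \<in> LE" and b: "b \<in> PB"
    obtain t where t: "a = {x \<in> space M. U k x \<le> t}" using a unfolding LE_def by blast
    obtain A B where AB: "b = A \<inter> B" "A \<in> F (Suc k)" "B \<in> R (Suc k)" using PBE[OF b] by blast
    have "prob (a \<inter> b) = clip01 t * prob A * prob B"
      using prob_U_le[OF AB(2,3), of t] unfolding t AB(1) by (simp add: Int_assoc)
    then show "prob (a \<inter> b) = prob a * prob b"
      unfolding AB(1) prob_past_Int[OF AB(2,3)] unfolding t U_law by simp
  qed
  moreover have "Int_stable LE"
  proof (rule Int_stableI)
    fix a b assume "a \<in> LE" "b \<in> LE"
    then obtain s t where "a = {x \<in> space M. U k x \<le> s}" "b = {x \<in> space M. U k x \<le> t}"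
      unfolding LE_def by blast
    then have "a \<inter> b = {x \<in> space M. U k x \<le> min s t}" by auto
    then show "a \<inter> b \<in> LE" unfolding LE_def by blast
  qed
  moreover have "Int_stable PB"
  proof (rule Int_stableI)
    fix a b assume "a \<in> PB" "b \<in> PB"
    then obtain A B A' B' where *: "a = A \<inter> B" "b = A' \<inter> B'" "A \<in> F (Suc k)" "A' \<in> F (Suc k)"
      "B \<in> R (Suc k)" "B' \<in> R (Suc k)" using PBE by meson
    have "a \<inter> b = (A \<inter> A') \<inter> (B \<inter> B')" unfolding * by auto
    then show "a \<inter> b \<in> PB" using PBI[OF F.Int[OF *(3,4)] R.Int[OF *(5,6)]] by simp
  qed
  ultimately have indep: "indep_set (sigma_sets (space M) LE) (sigma_sets (space M) PB)"
    by (rule indep_set_sigma_sets)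
  have LE: "sa_of (space M) (U k) borel \<subseteq> sigma_sets (space M) LE"
  proof -
    have "U k \<in> space M \<rightarrow> UNIV" by simp
    from sigma_sets_vimage_commute[OF this, of "range (\<lambda>a. {..a})"]
    have "sa_of (space M) (U k) borel = sigma_sets (space M) {U k -` A \<inter> space M | A. A \<in> range (\<lambda>a. {..a})}"
      unfolding sa_of_def borel_eq_atMost by simp
    also have "\<dots> \<subseteq> sigma_sets (space M) LE"
    proof (rule sigma_sets_mono', clarify)
      fix a :: real
      have "U k -` {..a} \<inter> space M = {x \<in> space M. U k x \<le> a}" by auto
      then show "U k -` {..a} \<inter> space M \<in> LE" unfolding LE_def by blast
    qed
    finally show ?thesis .
  qed
  have PBsp: "PB \<subseteq> Pow (space M)" using PBM sets.sets_into_space by blast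
  have sa: "sigma_algebra (space M) (sigma_sets (space M) PB)"
    by (rule sigma_algebra_sigma_sets[OF PBsp])
  have FPB: "F (Suc k) \<subseteq> sigma_sets (space M) PB"
  proof
    fix A assume A: "A \<in> F (Suc k)"
    then show "A \<in> sigma_sets (space M) PB"
      using PBI[OF A R.top] F.sets_into_space[OF A] by (simp add: Int_absorb2)
  qed
  have RPB: "R (Suc k) \<subseteq> sigma_sets (space M) PB"
  proof
    fix B assume B: "B \<in> R (Suc k)"
    then show "B \<in> sigma_sets (space M) PB"
      using PBI[OF F.top B] R.sets_into_space[OF B] by (simp add: Int_absorb1)
  qed
  \<comment> \<open>\<open>U j\<close> reads \<open>V j\<close>, \<open>V (Suc j)\<close> and
    \<open>r j\<close>, all at depth at least \<open>Suc k\<close>.\<close>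
  have UPB: "sa_of (space M) (U j) borel \<subseteq> sigma_sets (space M) PB" if j: "j \<ge> Suc k" for j
  proof (rule measurable_sigma_imp_sa_of_subset[OF sa])
    let ?S = "sigma (space M) (sigma_sets (space M) PB)"
    have setsS: "sets ?S = sigma_sets (space M) PB" by (rule sigma_algebra.sets_measure_of_eq[OF sa])
    have V: "V i \<in> ?S \<rightarrow>\<^sub>M count_space UNIV" if "i \<ge> Suc k" for i
    proof (rule measurableI)
      fix A have "V i -` A \<inter> space M \<in> F (Suc k)"
        using sa_of_subset_sa_fam[of i "{Suc k..}" "space M" V "count_space UNIV"] that
        unfolding nat_filt_def sa_of_def by auto
      then show "V i -` A \<inter> space ?S \<in> sets ?S" unfolding setsS using FPB by (auto simp: space_measure_of_conv)
    qed simp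
    have r: "r j \<in> borel_measurable ?S"
    proof (rule measurableI)
      fix A :: "real set" assume "A \<in> sets borel"
      then have "r j -` A \<inter> space M \<in> R (Suc k)"
        using sa_of_subset_sa_fam[of j "{Suc k..}" "space M" r borel] j
        unfolding sa_of_def by auto
      then show "r j -` A \<inter> space ?S \<in> sets ?S" unfolding setsS using RPB by (auto simp: space_measure_of_conv)
    qed simp
    show "U j \<in> borel_measurable ?S" using V[of j] V[of "Suc j"] r j by (intro U_measurable_if) auto
  qed
  have "sigma_sets (space M) (F (Suc k) \<union> sa_fam (space M) U borel {Suc k..}) \<subseteq> sigma_sets (space M) PB"
    by (intro sigma_algebra.sigma_sets_subset[OF sa] Un_least FPB sa_fam_subset[OF sa] UPB) auto
  with indep LE show ?thesis
    unfolding indep_set_def by (elim indep_sets_mono_sets) (auto split: bool.split)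
qed

lemma pascal_flow:
  assumes "\<And>A. A \<in> (\<Inter>k. F k) \<Longrightarrow> prob A = 0 \<or> prob A = 1"
  shows "pascal_flow M V U q"
proof
  show "prob A = 0 \<or> prob A = 1" if "A \<in> (\<Inter>k. F k)" for A using that by (rule assms)
qed (rule V_measurable U_measurable V_le V_eq_pascal_step indep_innovation; assumption?)+

end

section \<open>Construction of the copy\<close>

lemma space_pascal_space: "space pascal_space = pascal_paths"
  by (simp add: pascal_space_def space_restrict_space space_PiM)

text \<open>The decoder. It turns every real sequence, also one that encodes nothing, into a Pascal
  path, so the path constraints hold at all points of the copy.\<close>

definition path_of :: "(nat \<Rightarrow> real) \<Rightarrow> nat \<Rightarrow> nat" where
  "path_of x k = card {j. j < k \<and> 1 \<le> x j}"

lemma path_of_0: "path_of x 0 = 0"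
  by (simp add: path_of_def)

lemma path_of_Suc: "path_of x (Suc k) = path_of x k + (if 1 \<le> x k then 1 else 0)"
proof -
  have "{j. j < Suc k \<and> 1 \<le> x j} = {j. j < k \<and> 1 \<le> x j} \<union> (if 1 \<le> x k then {k} else {})"
    by (auto simp: less_Suc_eq)
  then show ?thesis by (simp add: path_of_def)
qed

lemma path_of_in_pascal_paths: "path_of x \<in> pascal_paths"
  by (simp add: pascal_paths_def path_of_0 path_of_Suc)

text \<open>A path and a sequence of fractional parts are stored in a single real sequence: the integer
  parts are the increments of the path.\<close>

definition encode :: "(nat \<Rightarrow> nat) \<times> (nat \<Rightarrow> real) \<Rightarrow> nat \<Rightarrow> real" where
  "encode z k = real (fst z (Suc k) - fst z k) + frac (snd z k)"

lemma path_of_encode: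
  assumes "fst z \<in> pascal_paths" shows "path_of (encode z) = fst z"
proof
  fix k show "path_of (encode z) k = fst z k"
  proof (induction k)
    case 0 then show ?case using assms by (simp add: path_of_0 pascal_paths_def)
  next
    case (Suc k)
    have "fst z (Suc k) = fst z k \<or> fst z (Suc k) = Suc (fst z k)" using assms by (simp add: pascal_paths_def)
    then show ?case
      using Suc frac_lt_1[of "snd z k"]
      by (auto simp: path_of_Suc encode_def not_le not_less[THEN iffD2, OF frac_ge_0])
  qed
qed

lemma frac_encode: "frac (encode z k) = frac (snd z k)"
  using frac_add_int_left[of "real (fst z (Suc k) - fst z k)" "frac (snd z k)"] by (simp add: encode_def)

lemma borel_measurable_frac[measurable]: "(frac :: real \<Rightarrow> real) \<in> borel_measurable borel"
  unfolding frac_def by measurable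

section \<open>Independent uniform variables\<close>

definition uniform01 :: "real measure" where
  "uniform01 = uniform_measure lborel {0..<1}"

lemma prob_space_uniform01: "prob_space uniform01"
  unfolding uniform01_def by (rule prob_space_uniform_measure) auto

lemma sets_uniform01[measurable_cong]: "sets uniform01 = sets borel"
  by (simp add: uniform01_def)

lemma space_uniform01: "space uniform01 = UNIV"
  by (simp add: uniform01_def)

lemma measure_uniform01_frac_le: "measure uniform01 {t. frac t \<le> a} = clip01 a"
proof -
  have [measurable]: "{t::real. frac t \<le> a} \<in> sets borel"
  proof -
    have "{t \<in> space borel. frac (t::real) \<le> a} \<in> sets borel" by measurable
    then show ?thesis by simp
  qed
  have "measure uniform01 {t. frac t \<le> a} = measure lborel ({0..<1} \<inter> {t. frac t \<le> a})"
    unfolding uniform01_def by (subst measure_uniform_measure) auto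
  also have "{0..<1} \<inter> {t::real. frac t \<le> a} = {0..<1} \<inter> {..a}" by auto
  also have "\<dots> = (if a < 0 then {} else if a < 1 then {0..a} else {0..<1})" by auto
  also have "measure lborel \<dots> = clip01 a" by (auto simp: clip01_def)
  finally show ?thesis .
qed

definition uniform_seq :: "(nat \<Rightarrow> real) measure" where
  "uniform_seq = Pi\<^sub>M UNIV (\<lambda>_. uniform01)"

lemma prob_space_uniform_seq: "prob_space uniform_seq"
  unfolding uniform_seq_def by (intro prob_space_PiM prob_space_uniform01)

lemma space_uniform_seq: "space uniform_seq = UNIV"
  by (simp add: uniform_seq_def space_PiM space_uniform01)

lemma coordinate_uniform_seq[measurable]: "(\<lambda>y. y k) \<in> uniform_seq \<rightarrow>\<^sub>M uniform01"
  unfolding uniform_seq_def by simp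

lemma frac_coordinate_uniform_seq: "(\<lambda>y. frac (y k)) \<in> borel_measurable uniform_seq"
proof -
  have "(\<lambda>y. y k) \<in> borel_measurable uniform_seq"
    using coordinate_uniform_seq[of k] by (simp add: measurable_cong_sets[OF refl sets_uniform01])
  then show ?thesis by measurable
qed

lemma indep_coordinates_uniform_seq:
  "prob_space.indep_vars uniform_seq (\<lambda>_. uniform01) (\<lambda>i y. y i) UNIV"
proof -
  interpret prob_space uniform_seq by (rule prob_space_uniform_seq)
  show ?thesis
  proof (subst indep_vars_iff_distr_eq_PiM)
    have "distr uniform_seq uniform01 (\<lambda>y. y i) = uniform01" for i
      unfolding uniform_seq_def by (rule distr_PiM_component) (auto simp: prob_space_uniform01)
    moreover have "distr uniform_seq uniform_seq (\<lambda>y. y) = uniform_seq" by (rule distr_id)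
    ultimately show "distr uniform_seq (Pi\<^sub>M UNIV (\<lambda>_. uniform01)) (\<lambda>y. \<lambda>i\<in>UNIV. y i) =
        Pi\<^sub>M UNIV (\<lambda>i. distr uniform_seq uniform01 (\<lambda>y. y i))"
      by (simp add: uniform_seq_def restrict_UNIV)
  qed auto
qed

lemma measure_uniform_seq_split:
  assumes B: "B \<in> sa_fam UNIV (\<lambda>j y. frac (y j)) borel {Suc k..}"
  shows "measure uniform_seq ({y. frac (y k) \<le> a} \<inter> B) = clip01 a * measure uniform_seq B"
proof -
  interpret prob_space uniform_seq by (rule prob_space_uniform_seq)
  let ?E = "\<lambda>i. {(\<lambda>y. y i) -` A \<inter> space uniform_seq | A. A \<in> sets uniform01}"
  let ?I = "\<lambda>b. if b then {k} else {Suc k..}"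
  have frac_sets: "frac -` A \<in> sets uniform01" if "A \<in> sets borel" for A :: "real set"
    using measurable_sets[OF borel_measurable_frac that] by (simp add: sets_uniform01)
  have E: "indep_sets ?E UNIV"
    using indep_coordinates_uniform_seq unfolding indep_vars_def2 by blast
  \<comment> \<open>The coordinates are grouped into two blocks, \<open>{k}\<close> and everything
    deeper, indexed by a Boolean.\<close>
  have "indep_sets (\<lambda>b. sigma_sets (space uniform_seq) (\<Union>i\<in>?I b. ?E i)) (UNIV :: bool set)"
  proof (rule indep_sets_collect_sigma)
    show "indep_sets ?E (\<Union>b\<in>UNIV. ?I b)" by (rule indep_sets_mono_index[OF _ E]) simp
    show "Int_stable (?E i)" for i
    proof (rule Int_stableI)
      fix a b assume "a \<in> ?E i" "b \<in> ?E i"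
      then obtain A A' where "A \<in> sets uniform01" "A' \<in> sets uniform01"
        "a = (\<lambda>y. y i) -` A \<inter> space uniform_seq" "b = (\<lambda>y. y i) -` A' \<inter> space uniform_seq" by blast
      then show "a \<inter> b \<in> ?E i" by (intro CollectI exI[of _ "A \<inter> A'"]) auto
    qed
    show "disjoint_family_on ?I (UNIV :: bool set)" by (auto simp: disjoint_family_on_def)
  qed
  note ind = this
  let ?L = "{y. frac (y k) \<le> a}"
  have L: "?L = (\<lambda>y. y k) -` (frac -` {..a}) \<inter> space uniform_seq" by (auto simp: space_uniform_seq)
  have LT: "?L \<in> sigma_sets (space uniform_seq) (\<Union>i\<in>?I True. ?E i)"
    unfolding L using frac_sets[of "{..a}"] by (auto intro!: sigma_sets.Basic)
  have BF: "B \<in> sigma_sets (space uniform_seq) (\<Union>i\<in>?I False. ?E i)"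
  proof -
    have "sa_fam UNIV (\<lambda>j y. frac (y j)) borel {Suc k..} \<subseteq> sigma_sets (space uniform_seq) (\<Union>i\<in>?I False. ?E i)"
      unfolding sa_fam_def space_uniform_seq
    proof (rule sigma_sets_mono', rule UN_mono)
      fix j assume "j \<in> {Suc k..}"
      show "sa_of UNIV (\<lambda>y. frac (y j)) borel \<subseteq> {(\<lambda>y. y j) -` A \<inter> UNIV | A. A \<in> sets uniform01}"
      proof
        fix C :: "(nat \<Rightarrow> real) set" assume "C \<in> sa_of UNIV (\<lambda>y. frac (y j)) borel"
        then obtain A where "A \<in> sets borel" "C = (\<lambda>y. frac (y j)) -` A \<inter> UNIV" unfolding sa_of_def by blast
        then show "C \<in> {(\<lambda>y. y j) -` A \<inter> UNIV | A. A \<in> sets uniform01}"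
          using frac_sets[of A] by (intro CollectI exI[of _ "frac -` A"]) auto
      qed
    qed simp
    then show ?thesis using B by blast
  qed
  have "prob (\<Inter>b\<in>UNIV. if b then ?L else B) = (\<Prod>b\<in>UNIV. prob (if b then ?L else B))"
    by (rule indep_setsD[OF ind]) (use LT BF in auto)
  then have "prob (?L \<inter> B) = prob ?L * prob B" by (simp add: UNIV_bool Int_commute mult.commute)
  moreover have "prob ?L = clip01 a"
  proof -
    have "prob ?L = measure (distr uniform_seq uniform01 (\<lambda>y. y k)) {t. frac t \<le> a}"
      using frac_sets[of "{..a}"] unfolding L by (subst measure_distr) (auto simp: vimage_def)
    also have "distr uniform_seq uniform01 (\<lambda>y. y k) = uniform01"
      unfolding uniform_seq_def by (rule distr_PiM_component) (auto simp: prob_space_uniform01)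
    finally show ?thesis by (simp add: measure_uniform01_frac_le)
  qed
  ultimately show ?thesis by simp
qed

section \<open>The copy on real sequences\<close>

locale pascal_measure = base: prob_space P for P :: "(nat \<Rightarrow> nat) measure" +
  assumes sets_P: "sets P = sets pascal_space"
    and ergodic: "pascal_ergodic P"
    and markov: "pascal_markov P"
begin

lemma space_P: "space P = pascal_paths"
  using sets_eq_imp_space_eq[OF sets_P] by (simp add: space_pascal_space)

lemma coord_measurable: "coord k \<in> P \<rightarrow>\<^sub>M count_space UNIV"
proof -
  have "(\<lambda>\<omega>. \<omega> k) \<in> pascal_space \<rightarrow>\<^sub>M count_space UNIV"
    unfolding pascal_space_def by (intro measurable_restrict_space1 measurable_component_singleton) simp
  then have "(\<lambda>\<omega>. \<omega> k) \<in> P \<rightarrow>\<^sub>M count_space UNIV" by (simp add: measurable_cong_sets[OF sets_P refl])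
  then show ?thesis by (simp add: coord_def[abs_def])
qed

lemma nat_filt_P_sets: "nat_filt P coord k \<subseteq> sets P"
  unfolding nat_filt_def by (intro sa_fam_subset_sets coord_measurable)

definition Q :: "(nat \<Rightarrow> real) measure" where
  "Q = distr (P \<Otimes>\<^sub>M uniform_seq) (Pi\<^sub>M UNIV (\<lambda>_. borel)) encode"

definition V :: "nat \<Rightarrow> (nat \<Rightarrow> real) \<Rightarrow> nat" where
  "V k x = path_of x k"

definition r :: "nat \<Rightarrow> (nat \<Rightarrow> real) \<Rightarrow> real" where
  "r k x = frac (x k)"

lemma encode_measurable[measurable]: "encode \<in> P \<Otimes>\<^sub>M uniform_seq \<rightarrow>\<^sub>M Pi\<^sub>M UNIV (\<lambda>_. borel)"
proof (rule measurable_PiM_single')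
  fix k
  have [measurable]: "(\<lambda>z. fst z j) \<in> P \<Otimes>\<^sub>M uniform_seq \<rightarrow>\<^sub>M count_space UNIV" for j
    using measurable_compose[OF measurable_fst coord_measurable[of j]] by (simp add: coord_def)
  have [measurable]: "(\<lambda>z. frac (snd z k)) \<in> borel_measurable (P \<Otimes>\<^sub>M uniform_seq)"
    using measurable_compose[OF measurable_snd frac_coordinate_uniform_seq] .
  have "(\<lambda>z. real (fst z (Suc k) - fst z k)) \<in> borel_measurable (P \<Otimes>\<^sub>M uniform_seq)"
    by measurable
  then show "(\<lambda>z. encode z k) \<in> borel_measurable (P \<Otimes>\<^sub>M uniform_seq)"
    unfolding encode_def by measurable
qed simp

lemma space_Q: "space Q = UNIV"
  by (simp add: Q_def space_PiM)

lemma prob_space_Q: "prob_space Q"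
proof -
  interpret prob_space uniform_seq by (rule prob_space_uniform_seq)
  interpret PU: pair_prob_space P uniform_seq ..
  show ?thesis unfolding Q_def by (rule PU.prob_space_distr) simp
qed

lemma coordinate_Q[measurable]: "(\<lambda>x. x k) \<in> borel_measurable Q"
  unfolding Q_def by simp

lemma V_measurable: "V k \<in> Q \<rightarrow>\<^sub>M count_space UNIV"
proof (induction k)
  case 0 then show ?case by (simp add: V_def[abs_def] path_of_0)
next
  case (Suc k)
  note [measurable] = Suc
  have "(\<lambda>x. V k x + (if 1 \<le> x k then 1 else 0)) \<in> Q \<rightarrow>\<^sub>M count_space UNIV" by measurable
  then show ?case by (simp add: V_def[abs_def] path_of_Suc)
qed

lemma r_measurable: "r k \<in> borel_measurable Q"
  unfolding r_def[abs_def] by measurable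

lemma nat_filt_Q: "nat_filt Q V k = (\<lambda>A. path_of -` A) ` nat_filt P coord k"
proof -
  have "path_of \<in> space Q \<rightarrow> space P" by (simp add: space_P path_of_in_pascal_paths)
  from sa_fam_comp[OF this, of coord "count_space UNIV" "{k..}"] show ?thesis
    by (simp add: nat_filt_def V_def[abs_def] coord_def space_Q)
qed

text \<open>Path and fractional parts are independent under \<open>Q\<close>: decoding recovers the
  first component of the product, and fractional parts are unchanged by encoding.\<close>

lemma measure_Q_Int:
  assumes A: "A \<in> sets P" and B: "B \<in> sa_fam UNIV (\<lambda>j y. frac (y j)) borel J"
    and meas: "path_of -` A \<in> sets Q"
  shows "measure Q (path_of -` A \<inter> B) = measure P A * measure uniform_seq B"
proof -
  interpret U: prob_space uniform_seq by (rule prob_space_uniform_seq)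
  interpret PU: pair_prob_space P uniform_seq ..
  have BU: "B \<in> sets uniform_seq"
    using B sa_fam_subset_sets[of J "\<lambda>j y. frac (y j)" uniform_seq borel] frac_coordinate_uniform_seq
    by (auto simp: space_uniform_seq)
  have BQ: "B \<in> sets Q"
    using B sa_fam_subset_sets[of J "\<lambda>j y. frac (y j)" Q borel] r_measurable
    by (auto simp: space_Q r_def[abs_def])
  have inv: "encode z \<in> B \<longleftrightarrow> snd z \<in> B" for z
  proof -
    have "B \<in> (\<lambda>B. (\<lambda>(y :: nat \<Rightarrow> real) j. frac (y j)) -` B \<inter> UNIV) ` sa_fam UNIV (\<lambda>j y. y j) borel J"
      using B sa_fam_comp[of "\<lambda>(y :: nat \<Rightarrow> real) j. frac (y j)" UNIV UNIV "\<lambda>j y. y j" borel J] by simp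
    then obtain B1 where "B = (\<lambda>y j. frac (y j)) -` B1 \<inter> UNIV" by blast
    then show ?thesis by (simp add: frac_encode)
  qed
  have "measure Q (path_of -` A \<inter> B) =
      measure (P \<Otimes>\<^sub>M uniform_seq) (encode -` (path_of -` A \<inter> B) \<inter> space (P \<Otimes>\<^sub>M uniform_seq))"
    unfolding Q_def using meas BQ by (intro measure_distr) (auto simp: Q_def)
  also have "encode -` (path_of -` A \<inter> B) \<inter> space (P \<Otimes>\<^sub>M uniform_seq) = A \<times> B"
    using sets.sets_into_space[OF A]
    by (auto simp: space_pair_measure space_P space_uniform_seq inv path_of_encode)
  also have "measure (P \<Otimes>\<^sub>M uniform_seq) (A \<times> B) = measure P A * measure uniform_seq B"
    using U.emeasure_pair_measure_Times[OF A BU]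
    by (simp add: PU.emeasure_eq_measure base.emeasure_eq_measure U.emeasure_eq_measure ennreal_mult[symmetric])
  finally show ?thesis .
qed

lemma nat_filt_Q_sets: "nat_filt Q V k \<subseteq> sets Q"
  unfolding nat_filt_def by (intro sa_fam_subset_sets V_measurable)

lemma measure_Q_path_of:
  assumes "A \<in> nat_filt P coord k"
  shows "measure Q (path_of -` A) = measure P A"
proof -
  interpret U: prob_space uniform_seq by (rule prob_space_uniform_seq)
  have "path_of -` A \<in> nat_filt Q V k" unfolding nat_filt_Q using assms by (rule imageI)
  then have "path_of -` A \<in> sets Q" using nat_filt_Q_sets by blast
  moreover have "A \<in> sets P" using assms nat_filt_P_sets by blast
  moreover have "UNIV \<in> sa_fam UNIV (\<lambda>j y. frac (y j :: real)) borel ({} :: nat set)"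
    unfolding sa_fam_def by (rule sigma_sets_top)
  ultimately have "measure Q (path_of -` A \<inter> UNIV) = measure P A * measure uniform_seq UNIV"
    by (intro measure_Q_Int)
  then show ?thesis using U.prob_space by (simp add: space_uniform_seq)
qed

lemma coord_in_nat_filt: "j \<ge> k \<Longrightarrow> {\<omega> \<in> space P. T (\<omega> j)} \<in> nat_filt P coord k"
proof -
  assume "j \<ge> k"
  have "{\<omega> \<in> space P. T (\<omega> j)} \<in> sa_of (space P) (coord j) (count_space UNIV)"
    unfolding sa_of_def by (intro CollectI exI[of _ "{w. T w}"]) (auto simp: coord_def)
  then show ?thesis
    unfolding nat_filt_def using sa_of_subset_sa_fam[of j "{k..}"] \<open>j \<ge> k\<close> by blast
qed

lemma tail_trivial_Q:
  assumes "A \<in> (\<Inter>k. nat_filt Q V k)"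
  shows "measure Q A = 0 \<or> measure Q A = 1"
proof -
  have "\<exists>C. C \<in> nat_filt P coord k \<and> A = path_of -` C" for k
  proof -
    have "A \<in> nat_filt Q V k" using assms by simp
    then show ?thesis unfolding nat_filt_Q by blast
  qed
  then obtain C where C: "\<And>k. C k \<in> nat_filt P coord k" "\<And>k. A = path_of -` C k" by metis
  have eq: "C k = path_of ` A" for k
  proof -
    have "C k \<in> sets P" using C(1) nat_filt_P_sets by blast
    then have sub: "C k \<subseteq> pascal_paths" using sets.sets_into_space space_P by metis
    have "\<omega> \<in> range path_of" if "\<omega> \<in> C k" for \<omega>
    proof -
      have "path_of (encode (\<omega>, \<lambda>_. 0)) = \<omega>" using path_of_encode[of "(\<omega>, \<lambda>_. 0)"] sub that by auto
      then show ?thesis by (metis rangeI)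
    qed
    then have "C k = path_of ` (path_of -` C k)" by (auto simp: image_vimage_eq)
    then show ?thesis using C(2)[of k] by simp
  qed
  then have "path_of ` A \<in> (\<Inter>k. nat_filt P coord k)" using C(1) by simp
  then have "measure P (path_of ` A) = 0 \<or> measure P (path_of ` A) = 1"
    using ergodic by (simp add: pascal_ergodic_def)
  moreover have "measure Q A = measure P (path_of ` A)"
    using measure_Q_path_of[OF C(1)[of 0]] by (simp only: C(2)[of 0, symmetric]) (simp only: eq)
  ultimately show ?thesis by simp
qed

sublocale pascal_randomized Q V r
proof (intro pascal_randomized.intro vertex_process.intro vertex_process_axioms.intro pascal_randomized_axioms.intro)
  show "prob_space Q" by (rule prob_space_Q)
  show "V k \<in> Q \<rightarrow>\<^sub>M count_space UNIV" for k by (rule V_measurable)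
  show "r k \<in> borel_measurable Q" for k by (rule r_measurable)
  show "V 0 x = 0" for x by (simp add: V_def path_of_0)
  show "V (Suc k) x = V k x \<or> V (Suc k) x = Suc (V k x)" for k x by (simp add: V_def path_of_Suc)
  show "0 \<le> r k x \<and> r k x < 1" for k x by (simp add: r_def frac_lt_1)
next
  fix A k v w assume "A \<in> nat_filt Q V (Suc k)"
  then obtain C where C: "C \<in> nat_filt P coord (Suc k)" "A = path_of -` C" unfolding nat_filt_Q by blast
  interpret S: sigma_algebra "space P" "nat_filt P coord j" for j
    unfolding nat_filt_def by (rule sa_fam_sigma_algebra)
  let ?W = "{\<omega> \<in> space P. \<omega> (Suc k) = w}" and ?VW = "{\<omega> \<in> space P. \<omega> k = v \<and> \<omega> (Suc k) = w}"
  have W: "?W \<in> nat_filt P coord (Suc k)" by (rule coord_in_nat_filt) simp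
  have WC: "?W \<inter> C \<in> nat_filt P coord (Suc k)" using W C(1) by (rule S.Int)
  have "?VW = {\<omega> \<in> space P. \<omega> k = v} \<inter> ?W" by auto
  then have VW: "?VW \<in> nat_filt P coord k"
    using S.Int[OF coord_in_nat_filt[of k k "\<lambda>y. y = v"] coord_in_nat_filt[of k "Suc k" "\<lambda>y. y = w"]] by simp
  have "C \<in> nat_filt P coord k"
    using C(1) sa_fam_mono[of "{Suc k..}" "{k..}" "space P" coord "count_space UNIV"]
    by (auto simp: nat_filt_def)
  then have VWC: "?VW \<inter> C \<in> nat_filt P coord k" using VW by (rule S.Int[rotated])
  have eqs: "{x \<in> space Q. V k x = v \<and> V (Suc k) x = w} = path_of -` ?VW"
      "{x \<in> space Q. V (Suc k) x = w} = path_of -` ?W"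
      "path_of -` ?VW \<inter> A = path_of -` (?VW \<inter> C)" "path_of -` ?W \<inter> A = path_of -` (?W \<inter> C)"
    by (auto simp: space_Q V_def space_P path_of_in_pascal_paths C(2))
  show "measure Q ({x \<in> space Q. V k x = v \<and> V (Suc k) x = w} \<inter> A) * measure Q {x \<in> space Q. V (Suc k) x = w} =
      measure Q {x \<in> space Q. V k x = v \<and> V (Suc k) x = w} * measure Q ({x \<in> space Q. V (Suc k) x = w} \<inter> A)"
    unfolding eqs measure_Q_path_of[OF W] measure_Q_path_of[OF WC] measure_Q_path_of[OF VW] measure_Q_path_of[OF VWC]
    using markov C(1) unfolding pascal_markov_def by blast
next
  fix A B k a assume A: "A \<in> nat_filt Q V 0" and B: "B \<in> sa_fam (space Q) r borel {Suc k..}"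
  obtain C where C: "C \<in> nat_filt P coord 0" "A = path_of -` C" using A unfolding nat_filt_Q by blast
  have CP: "C \<in> sets P" using C(1) nat_filt_P_sets by blast
  have AQ: "path_of -` C \<in> sets Q" using A C(2) nat_filt_Q_sets by blast
  have B': "B \<in> sa_fam UNIV (\<lambda>j y. frac (y j)) borel {Suc k..}"
    using B by (simp add: space_Q r_def[abs_def])
  let ?X = "\<lambda>(j::nat) (y :: nat \<Rightarrow> real). frac (y j)"
  let ?L = "{y :: nat \<Rightarrow> real. frac (y k) \<le> a}"
  interpret S: sigma_algebra UNIV "sa_fam UNIV ?X borel {k..}" by (rule sa_fam_sigma_algebra)
  have "?L \<in> sa_of UNIV (?X k) borel"
    unfolding sa_of_def by (intro CollectI exI[of _ "{..a}"]) auto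
  then have "?L \<in> sa_fam UNIV ?X borel {k..}"
    using sa_of_subset_sa_fam[of k "{k..}" UNIV ?X borel] by auto
  moreover have "B \<in> sa_fam UNIV ?X borel {k..}"
    using B' sa_fam_mono[of "{Suc k..}" "{k..}" UNIV ?X borel] by auto
  ultimately have LB: "?L \<inter> B \<in> sa_fam UNIV ?X borel {k..}" by (rule S.Int)
  have top: "path_of -` space P = UNIV" by (auto simp: space_P path_of_in_pascal_paths)
  \<comment> \<open>Taking the whole path space as path event yields the law of the fractional parts
    alone.\<close>
  have "measure Q (path_of -` space P \<inter> B) = measure P (space P) * measure uniform_seq B"
    by (rule measure_Q_Int[OF _ B']) (use top sets.top[of Q] in \<open>auto simp: space_Q\<close>)
  then have QB: "measure Q B = measure uniform_seq B" unfolding top by (simp add: base.prob_space)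
  have "measure Q (A \<inter> {x \<in> space Q. r k x \<le> a} \<inter> B) = measure Q (path_of -` C \<inter> (?L \<inter> B))"
    by (rule arg_cong[where f="measure Q"]) (auto simp: C(2) space_Q r_def)
  also have "\<dots> = measure P C * measure uniform_seq (?L \<inter> B)"
    by (rule measure_Q_Int[OF CP LB AQ])
  also have "\<dots> = measure P C * (clip01 a * measure uniform_seq B)"
    by (simp only: measure_uniform_seq_split[OF B'])
  also have "\<dots> = measure Q A * clip01 a * measure Q B"
    unfolding QB C(2) measure_Q_path_of[OF C(1)] by simp
  finally show "measure Q (A \<inter> {x \<in> space Q. r k x \<le> a} \<inter> B) = measure Q A * clip01 a * measure Q B" .
qed

sublocale flow: pascal_flow Q V U q
  by (rule pascal_flow[OF tail_trivial_Q])

lemma is_copy_Q: "is_copy Q V P"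
  unfolding is_copy_def
proof (intro conjI allI)
  let ?N = "Pi\<^sub>M UNIV (\<lambda>_. count_space UNIV) :: (nat \<Rightarrow> nat) measure"
  interpret U: prob_space uniform_seq by (rule prob_space_uniform_seq)
  show "prob_space Q" by (rule prob_space_Q)
  show "V k \<in> Q \<rightarrow>\<^sub>M count_space UNIV" for k by (rule V_measurable)
  have id: "(\<lambda>\<omega>. \<omega>) \<in> P \<rightarrow>\<^sub>M ?N"
    using coord_measurable by (intro measurable_PiM_single') (auto simp: coord_def[abs_def])
  have "(\<lambda>x k. V k x) \<in> Pi\<^sub>M UNIV (\<lambda>_. borel) \<rightarrow>\<^sub>M ?N"
    using V_measurable by (intro measurable_PiM_single') (auto simp: Q_def)
  then have "distr Q ?N (\<lambda>x k. V k x) = distr (P \<Otimes>\<^sub>M uniform_seq) ?N ((\<lambda>x k. V k x) \<circ> encode)"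
    unfolding Q_def by (rule distr_distr) simp
  \<comment> \<open>On Pascal paths decoding undoes encoding, so \<open>V\<close> after
    \<open>encode\<close> is the projection to the path.\<close>
  also have "\<dots> = distr (P \<Otimes>\<^sub>M uniform_seq) ?N ((\<lambda>\<omega>. \<omega>) \<circ> fst)"
    by (rule distr_cong) (auto simp: V_def space_pair_measure space_P path_of_encode)
  also have "\<dots> = distr (distr (P \<Otimes>\<^sub>M uniform_seq) P fst) ?N (\<lambda>\<omega>. \<omega>)"
    by (rule distr_distr[symmetric, OF id]) simp
  also have "\<dots> = distr P ?N (\<lambda>\<omega>. \<omega>)" by (simp only: U.distr_pair_fst)
  finally show "distr Q ?N (\<lambda>x k. V k x) = distr P ?N (\<lambda>\<omega>. \<omega>)" .
qed

lemma admits_generating_param: "admits_generating_param P"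
  unfolding admits_generating_param_def
proof (intro exI conjI allI)
  show "is_copy Q V P" by (rule is_copy_Q)
  show "U k \<in> borel_measurable Q" for k by (rule U_measurable)
  show "indep_set (sa_of (space Q) (U k) borel)
      (sigma_sets (space Q) (nat_filt Q V (Suc k) \<union> sa_fam (space Q) U borel {Suc k..}))" for k
    by (rule indep_innovation)
  show "nat_filt Q V k \<subseteq> aug_null Q (sigma_sets (space Q) (nat_filt Q V (Suc k) \<union> sa_of (space Q) (U k) borel))" for k
    using flow.F_subset_sigma_F_innovation subset_aug_null by blast
  show "nat_filt Q V k \<subseteq> aug_null Q (sa_fam (space Q) U borel {k..})" for k
    by (rule flow.F_subset_aug_null_G)
qed

lemma standard_filt: "standard_filt P"
  unfolding standard_filt_def
proof (intro exI conjI allI)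
  show "is_copy Q V P" by (rule is_copy_Q)
  show "U k \<in> borel_measurable Q" for k by (rule U_measurable)
  show "indep_vars (\<lambda>_. borel) U UNIV" by (rule flow.indep_vars_U)
  show "immersed (completion Q) (\<lambda>k. aug_null Q (nat_filt Q V k))
      (\<lambda>k. aug_null Q (sa_fam (space Q) U borel {k..}))"
    by (rule flow.immersed_F_G)
qed

end

theorem theorem6p2:
  fixes P :: "(nat \<Rightarrow> nat) measure"
  assumes "prob_space P"
      and "sets P = sets pascal_space"
      and "pascal_ergodic P"
      and "pascal_markov P"
  shows "admits_generating_param P \<and> standard_filt P"
proof -
  interpret pascal_measure P
    using assms by (simp add: pascal_measure_def pascal_measure_axioms_def)
  show ?thesis using admits_generating_param standard_filt ..
qed

end
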